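(* Let $k$ be a positive integer. Every $(2k+1)$-connected semicomplete digraph $D$ with $\delta^+(D)\geq 7k^2+36k$ is $k$-linked.
   Context: All digraphs are finite and simple: no loops and no multiple (parallel) arcs; a pair of opposite arcs $xy$, $yx$ is allowed. A digraph $D$ is semicomplete if there is at least one arc between every pair of distinct vertices of $D$. Paths are directed paths. The minimum out-degree $\delta^+(D)$ is the minimum over all vertices $x$ of $D$ of the number of vertices $y$ such that $xy$ is an arc of $D$. For a positive integer $m$, a digraph is $m$-connected if it has at least $m+1$ vertices and, after deleting any set $S$ of at most $m-1$ vertices, there exists a directed path from $x$ to $y$ for every ordered pair of distinct remaining vertices $x,y$. A digraph $D$ is $k$-linked if for every $2k$ distinct vertices $x_1,\ldots,x_k,y_1,\ldots,y_k$ in $D$, there exist $k$ pairwise vertex-disjoint directed paths $P_1,\ldots,P_k$ such that $P_i$ starts at $x_i$ and ends at $y_i$ for each $i\in\{1,\ldots,k\}$. *)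

theory Defs
  imports "Graph_Theory.Graph_Theory"
begin

definition vpath_betw :: "('a, 'b) pre_digraph \<Rightarrow> 'a \<Rightarrow> 'a list \<Rightarrow> 'a \<Rightarrow> bool" where
  "vpath_betw D u p v \<longleftrightarrow> vpath p D \<and> hd p = u \<and> last p = v"

definition semicomplete :: "('a, 'b) pre_digraph \<Rightarrow> bool" where
  "semicomplete D \<longleftrightarrow>
     (\<forall>x \<in> verts D. \<forall>y \<in> verts D. x \<noteq> y \<longrightarrow> x \<rightarrow>\<^bsub>D\<^esub> y \<or> y \<rightarrow>\<^bsub>D\<^esub> x)"

text \<open>
  \<^const>\<open>out_degree\<close> counts arcs rather than out-neighbours; without parallel arcs the two
  agree.
\<close>

lemma (in digraph) out_degree_eq_card_out_neighbours:
  "out_degree G x = card {y \<in> verts G. x \<rightarrow> y}"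
proof -
  have "{y \<in> verts G. x \<rightarrow> y} = head G ` out_arcs G x"
    by (auto simp: arcs_ends_conv out_arcs_def)
  moreover have "inj_on (head G) (out_arcs G x)"
    by (auto simp: inj_on_def arc_to_ends_def intro: no_multi_arcs)
  ultimately show ?thesis
    by (simp add: out_degree_def card_image)
qed

text \<open>Unspecified for the null digraph, as \<^const>\<open>Min\<close> of the empty set is.\<close>

definition min_out_degree :: "('a, 'b) pre_digraph \<Rightarrow> nat" where
  "min_out_degree D = Min (out_degree D ` verts D)"

text \<open>Only meaningful for \<open>m > 0\<close>, where \<open>card S < m\<close> says that \<open>S\<close> has at most \<open>m - 1\<close> elements.\<close>

definition m_connected :: "nat \<Rightarrow> ('a, 'b) pre_digraph \<Rightarrow> bool" where
  "m_connected m D \<longleftrightarrow>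
     m + 1 \<le> card (verts D) \<and>
     (\<forall>S \<subseteq> verts D. card S < m \<longrightarrow>
        (\<forall>x \<in> verts D - S. \<forall>y \<in> verts D - S. x \<noteq> y \<longrightarrow>
           (\<exists>p. vpath_betw (D \<restriction> (verts D - S)) x p y)))"

definition k_linked :: "nat \<Rightarrow> ('a, 'b) pre_digraph \<Rightarrow> bool" where
  "k_linked k D \<longleftrightarrow>
     (\<forall>x y. x ` {1..k} \<subseteq> verts D \<and> y ` {1..k} \<subseteq> verts D \<and>
            inj_on x {1..k} \<and> inj_on y {1..k} \<and> x ` {1..k} \<inter> y ` {1..k} = {} \<longrightarrow>
        (\<exists>P. (\<forall>i \<in> {1..k}. vpath_betw D (x i) (P i) (y i)) \<and>
             (\<forall>i \<in> {1..k}. \<forall>j \<in> {1..k}. i \<noteq> j \<longrightarrow> set (P i) \<inter> set (P j) = {})))"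

end

theory Submission
  imports Defs "HOL-Library.Disjoint_Sets"
begin

text \<open>
  Let \<open>X\<close> be the set of the \<open>x i\<close> and \<open>Y\<close> the set of the \<open>y i\<close>. As out-degrees are large, walks
  are easily started anywhere, but \<open>Y\<close> may be hard to reach: it may be accessible only along a few
  very long paths. So the long part of the linkage is built first, ending in \<open>Y\<close>, and the \<open>x i\<close> are
  joined to it afterwards. It starts in a hub \<open>W\<close>, which consists of \<open>3 * k\<close> vertices of largest
  in-degree outside \<open>X\<close> and \<open>Y\<close>.

  Two facts make the hub useful. First, counting non-in-neighbours shows that every vertex reaches
  every vertex of \<open>W\<close> by a walk with at most three arcs, even after the deletion of any set of size
  linear in \<open>k\<close> (lemma \<open>short_walk_to_hub\<close>). Second, if \<open>k\<close> disjoint paths from \<open>W\<close> to \<open>Y\<close> have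
  minimal total length, then a walk from an unused vertex of \<open>W\<close> that has avoided them cannot enter
  one of them deep inside, since this would be a shortcut (lemma \<open>shortest_linkage_entry\<close>). Hence,
  near the hub, only the first few vertices of these paths are in the way. An \<open>x i\<close> with many
  out-neighbours that are dominated by more than \<open>k\<close> hub vertices is therefore easily joined to the
  right path, and an out-neighbour \<open>z i\<close> outside \<open>W\<close> that is dominated by at most \<open>k\<close> hub vertices has
  arcs to at least \<open>2 * k\<close> of them.

  The difficulty is that all out-neighbours of \<open>x i\<close> may lie on the paths to \<open>Y\<close>, far from the hub.
  Then some of them have to be given up as second vertices \<open>z i\<close>, and the paths to \<open>Y\<close> must avoid
  all the chosen \<open>z i\<close> at once. This is where connectivity \<open>2 * k + 1\<close> enters: without \<open>X\<close> the
  digraph is \<open>(k + 1)\<close>-connected, so by Menger's theorem there are \<open>k + 1\<close> disjoint paths, here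
  called columns, from \<open>W\<close> to \<open>Y\<close> and one additional vertex \<open>e\<close>: one column more than needed. Think
  of \<open>k\<close> tokens that move up the columns. A token that meets a block \<open>z i\<close> changes to the spare
  column, and the column it left, above the block, becomes the spare one. The changes permute the
  tokens, which is harmless because inside the hub the starts can be assigned arbitrarily.

  A token can change columns if the blocks on the two columns are not level with each other. In a
  shortest system of columns, arcs between columns cannot be exchanged cyclically
  (lemma \<open>no_cyclic_exchange\<close>); together with semicompleteness this orders the columns well enough
  for a greedy choice of blocks from bottom to top, which uses up about four candidates per block
  (lemma \<open>choose_bridged_positions\<close>). To have the spare column reach above all blocks, \<open>e\<close> is taken
  of maximal out-degree and blocks are kept \<open>3 * k + 3\<close> positions away from the upper end
  (lemma \<open>linkage_avoiding_blocks\<close>). So about \<open>7 * k\<close> candidates on one of the \<open>k + 1\<close> columns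
  suffice, whence the quadratic bound on the out-degree.
\<close>

section \<open>Walks and linkages\<close>

definition rel_walk :: "'a rel \<Rightarrow> 'a list \<Rightarrow> bool" where
  "rel_walk E p \<longleftrightarrow> p \<noteq> [] \<and> successively (\<lambda>u v. (u, v) \<in> E) p"

definition linkage :: "'a rel \<Rightarrow> 'a set \<Rightarrow> 'a set \<Rightarrow> 'i set \<Rightarrow> ('i \<Rightarrow> 'a list) \<Rightarrow> bool" where
  "linkage E A B I P \<longleftrightarrow>
     (\<forall>i\<in>I. rel_walk E (P i) \<and> distinct (P i) \<and> hd (P i) \<in> A \<and> last (P i) \<in> B) \<and>
     disjoint_family_on (\<lambda>i. set (P i)) I"

text \<open>
  Walks, which may repeat vertices, are separated by the same sets as paths are, and pieces of
  different walks can be joined without a care for repetitions.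
\<close>

definition separates :: "'a rel \<Rightarrow> 'a set \<Rightarrow> 'a set \<Rightarrow> 'a set \<Rightarrow> bool" where
  "separates E A B S \<longleftrightarrow>
     (\<forall>p. rel_walk E p \<longrightarrow> hd p \<in> A \<longrightarrow> last p \<in> B \<longrightarrow> set p \<inter> S \<noteq> {})"

lemma separatesD:
  assumes "separates E A B S" "rel_walk E p" "hd p \<in> A" "last p \<in> B"
  shows "\<exists>v\<in>set p. v \<in> S"
  using assms unfolding separates_def by blast

lemma rel_walk_mono: "rel_walk E p \<Longrightarrow> E \<subseteq> F \<Longrightarrow> rel_walk F p"
  unfolding rel_walk_def by (auto intro: successively_mono)

lemma rel_walk_append_iff:
  assumes "p \<noteq> []" "q \<noteq> []"
  shows "rel_walk E (p @ q) \<longleftrightarrow> rel_walk E p \<and> rel_walk E q \<and> (last p, hd q) \<in> E"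
  using assms by (auto simp: rel_walk_def successively_append_iff)

lemma rel_walk_singleton [simp]: "rel_walk E [v]"
  by (simp add: rel_walk_def)

lemma rel_walk_cut_left: "rel_walk E (p @ v # q) \<Longrightarrow> rel_walk E (v # q)"
  by (auto simp: rel_walk_def successively_append_iff)

lemma rel_walk_cut_right: "rel_walk E (p @ v # q) \<Longrightarrow> rel_walk E (p @ [v])"
  by (auto simp: rel_walk_def successively_append_iff successively_Cons)

lemma rel_walk_crossover:
  assumes "rel_walk E (p @ v # p')" "rel_walk E (q @ v # q')"
  shows "rel_walk E (p @ v # q')"
  using assms by (auto simp: rel_walk_def successively_append_iff successively_Cons)

lemma rel_walk_subset:
  assumes "rel_walk E p" "hd p \<in> U" "E \<subseteq> U \<times> U"
  shows "set p \<subseteq> U"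
  using assms unfolding rel_walk_def
  by (induction "\<lambda>u v. (u, v) \<in> E" p rule: successively.induct) auto

lemma rel_walk_Restr:
  assumes "rel_walk E p" "set p \<subseteq> U"
  shows "rel_walk (Restr E U) p"
  using assms unfolding rel_walk_def
  by (induction "\<lambda>u v. (u, v) \<in> E" p rule: successively.induct) auto

lemma rel_walk_delete_arc:
  assumes "rel_walk E p" "\<not> rel_walk (E - {(x, y)}) p"
  shows "\<exists>q r. p = q @ [x, y] @ r"
  using assms unfolding rel_walk_def
proof (induction "\<lambda>u v. (u, v) \<in> E" p rule: successively.induct)
  case (3 a b p)
  show ?case
  proof (cases "(a, b) = (x, y)")
    case True
    then show ?thesis by (intro exI[of _ "[]"] exI[of _ p]) simp
  next
    case False
    then obtain q r where "b # p = q @ [x, y] @ r" using 3 by auto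
    then show ?thesis by (metis append_Cons)
  qed
qed auto

lemma linkage_reindex:
  assumes "linkage E A B I P" "inj_on f J" "f ` J \<subseteq> I"
  shows "linkage E A B J (P \<circ> f)"
  unfolding linkage_def
proof (intro conjI ballI)
  show "disjoint_family_on (\<lambda>i. set ((P \<circ> f) i)) J"
    unfolding disjoint_family_on_def
  proof (intro ballI impI)
    fix i j assume "i \<in> J" "j \<in> J" "i \<noteq> j"
    then have "f i \<in> I" "f j \<in> I" "f i \<noteq> f j" using assms(2,3) by (auto simp: inj_on_def)
    then show "set ((P \<circ> f) i) \<inter> set ((P \<circ> f) j) = {}"
      using assms(1) by (simp add: linkage_def disjoint_family_on_def)
  qed
qed (use assms(1,3) in \<open>auto simp: linkage_def\<close>)

lemma linkage_mono: "linkage E A B I P \<Longrightarrow> E \<subseteq> F \<Longrightarrow> linkage F A B I P"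
  by (auto simp: linkage_def intro: rel_walk_mono)

lemma linkage_disjoint:
  assumes "linkage E A B I P" "i \<in> I" "j \<in> I" "v \<in> set (P i)" "v \<in> set (P j)"
  shows "i = j"
  using assms unfolding linkage_def disjoint_family_on_def by blast

lemma linkage_inj_on_last:
  assumes "linkage E A B I P"
  shows "inj_on (\<lambda>i. last (P i)) I"
proof (rule inj_onI, rule ccontr)
  fix i j assume ij: "i \<in> I" "j \<in> I" "last (P i) = last (P j)" "i \<noteq> j"
  have "P i \<noteq> []" "P j \<noteq> []" using assms ij by (auto simp: linkage_def rel_walk_def)
  then have "last (P i) \<in> set (P i)" "last (P j) \<in> set (P j)" by simp_all
  then show False using assms ij by (auto simp: linkage_def disjoint_family_on_def)
qed

lemma linkage_inj_on_hd:
  assumes "linkage E A B I P"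
  shows "inj_on (\<lambda>i. hd (P i)) I"
proof (rule inj_onI, rule ccontr)
  fix i j assume ij: "i \<in> I" "j \<in> I" "hd (P i) = hd (P j)" "i \<noteq> j"
  have "P i \<noteq> []" "P j \<noteq> []" using assms ij by (auto simp: linkage_def rel_walk_def)
  then have "hd (P i) \<in> set (P i)" "hd (P j) \<in> set (P j)" by simp_all
  then show False using assms ij by (auto simp: linkage_def disjoint_family_on_def)
qed

lemma bij_betw_of_inj_into:
  assumes "inj_on f I" "f ` I \<subseteq> B" "finite B" "card I = card B"
  shows "bij_betw f I B"
  using assms by (simp add: bij_betw_def card_image card_subset_eq)

lemma linkage_bij_last:
  assumes "linkage E A B I P" "finite B" "card I = card B"
  shows "bij_betw (\<lambda>i. last (P i)) I B"
  using assms by (intro bij_betw_of_inj_into linkage_inj_on_last) (auto simp: linkage_def)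

lemma linkage_bij_hd:
  assumes "linkage E A B I P" "finite A" "card I = card A"
  shows "bij_betw (\<lambda>i. hd (P i)) I A"
  using assms by (intro bij_betw_of_inj_into linkage_inj_on_hd) (auto simp: linkage_def)

lemma linkage_index_by_last:
  assumes "linkage E A B I P" "finite B" "card I = card B"
  obtains Q where "linkage E A B B Q" "\<And>b. b \<in> B \<Longrightarrow> last (Q b) = b"
proof -
  note bij = linkage_bij_last[OF assms]
  let ?g = "the_inv_into I (\<lambda>i. last (P i))"
  have g: "bij_betw ?g B I" using bij by (rule bij_betw_the_inv_into)
  show thesis
  proof (rule that[of "P \<circ> ?g"])
    show "linkage E A B B (P \<circ> ?g)"
      using g by (intro linkage_reindex[OF assms(1)]) (auto simp: bij_betw_def)
    show "last ((P \<circ> ?g) b) = b" if "b \<in> B" for b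
      using f_the_inv_into_f[of "\<lambda>i. last (P i)" I b] bij that by (simp add: bij_betw_def)
  qed
qed

lemma linkage_index_by_hd:
  assumes "linkage E A B I P" "finite A" "card I = card A"
  obtains Q where "linkage E A B A Q" "\<And>a. a \<in> A \<Longrightarrow> hd (Q a) = a"
proof -
  note bij = linkage_bij_hd[OF assms]
  let ?g = "the_inv_into I (\<lambda>i. hd (P i))"
  have g: "bij_betw ?g A I" using bij by (rule bij_betw_the_inv_into)
  show thesis
  proof (rule that[of "P \<circ> ?g"])
    show "linkage E A B A (P \<circ> ?g)"
      using g by (intro linkage_reindex[OF assms(1)]) (auto simp: bij_betw_def)
    show "hd ((P \<circ> ?g) a) = a" if "a \<in> A" for a
      using f_the_inv_into_f[of "\<lambda>i. hd (P i)" I a] bij that by (simp add: bij_betw_def)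
  qed
qed

section \<open>Menger's theorem\<close>

lemma separates_inter: "separates {} A B (A \<inter> B)"
proof -
  have "set p \<inter> (A \<inter> B) \<noteq> {}" if p: "rel_walk {} p" "hd p \<in> A" "last p \<in> B" for p
  proof -
    obtain v q where "p = v # q" using p(1) by (cases p) (auto simp: rel_walk_def)
    moreover have "q = []" using p(1) calculation by (auto simp: rel_walk_def successively_Cons)
    ultimately show ?thesis using p by auto
  qed
  then show ?thesis by (auto simp: separates_def)
qed

text \<open>
  A walk up to its first vertex in \<open>S\<close> has not used an arc that starts in \<open>S\<close>, so it is still
  present after the deletion of such an arc, and \<open>T\<close> meets it.
\<close>

lemma separates_via_tail:
  assumes sep: "separates E A B S" and T: "separates (E - {(x, y)}) A S T" and "x \<in> S"
  shows "separates E A B T"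
  unfolding separates_def
proof (intro allI impI)
  fix p assume p: "rel_walk E p" "hd p \<in> A" "last p \<in> B"
  then have "\<exists>v\<in>set p. v \<in> S" using separatesD[OF sep] by blast
  then obtain q v r where v: "p = q @ v # r" "v \<in> S" "\<forall>u\<in>set q. u \<notin> S"
    using split_list_first_prop[of p "\<lambda>v. v \<in> S"] by blast
  have walk: "rel_walk E (q @ [v])" using p(1) v(1) by (auto intro: rel_walk_cut_right)
  have "rel_walk (E - {(x, y)}) (q @ [v])"
  proof (rule ccontr)
    assume "\<not> ?thesis"
    from rel_walk_delete_arc[OF walk this] obtain q' r' where "q @ [v] = q' @ [x, y] @ r'" by blast
    then have "q @ [v] = (q' @ [x]) @ (y # r')" by simp
    then have "x \<in> set q" by (cases r' rule: rev_cases) auto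
    then show False using v(3) \<open>x \<in> S\<close> by blast
  qed
  moreover have "hd (q @ [v]) \<in> A" using p(2) v(1) by (cases q) auto
  ultimately have "\<exists>u\<in>set (q @ [v]). u \<in> T" using v(2) by (intro separatesD[OF T]) auto
  then show "set p \<inter> T \<noteq> {}" using v(1) by auto
qed

lemma separates_via_head:
  assumes sep: "separates E A B S" and T: "separates (E - {(x, y)}) S B T" and "y \<in> S"
  shows "separates E A B T"
  unfolding separates_def
proof (intro allI impI)
  fix p assume p: "rel_walk E p" "hd p \<in> A" "last p \<in> B"
  then have "\<exists>v\<in>set p. v \<in> S" using separatesD[OF sep] by blast
  then obtain q v r where v: "p = q @ v # r" "v \<in> S" "\<forall>u\<in>set r. u \<notin> S"
    using split_list_last_prop[of p "\<lambda>v. v \<in> S"] by blast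
  have walk: "rel_walk E (v # r)" using p(1) v(1) by (auto intro: rel_walk_cut_left)
  have "rel_walk (E - {(x, y)}) (v # r)"
  proof (rule ccontr)
    assume "\<not> ?thesis"
    from rel_walk_delete_arc[OF walk this] obtain q' r' where "v # r = q' @ [x, y] @ r'" by blast
    then have "y \<in> set r" by (cases q') auto
    then show False using v(3) \<open>y \<in> S\<close> by blast
  qed
  moreover have "last (v # r) \<in> B" using p(3) v(1) by simp
  ultimately have "\<exists>u\<in>set (v # r). u \<in> T" using v(2) by (intro separatesD[OF T]) auto
  then show "set p \<inter> T \<noteq> {}" using v(1) by auto
qed

lemma separates_insert_end:
  assumes "separates (E - {(x, y)}) A B S" "z \<in> {x, y}"
  shows "separates E A B (insert z S)"
  unfolding separates_def
proof (intro allI impI)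
  fix p assume p: "rel_walk E p" "hd p \<in> A" "last p \<in> B"
  show "set p \<inter> insert z S \<noteq> {}"
  proof (cases "rel_walk (E - {(x, y)}) p")
    case True
    then show ?thesis using separatesD[OF assms(1) _ p(2,3)] by blast
  next
    case False
    then obtain q r where "p = q @ [x, y] @ r" using rel_walk_delete_arc[OF p(1)] by blast
    then show ?thesis using assms(2) by auto
  qed
qed

text \<open>
  Goering's induction on the number of arcs. If the deletion of the arc from \<open>x\<close> to \<open>y\<close> leaves a
  separator \<open>S\<close> that is too small, then both \<open>insert x S\<close> and \<open>insert y S\<close> are separators of size
  exactly \<open>n\<close>. By induction there are, without the arc, linkages from \<open>A\<close> onto the first and from the
  second to \<open>B\<close>; they can be joined in \<open>S\<close> and along the deleted arc.
\<close>

theorem menger: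
  assumes "finite E" "finite A" "finite B" "irrefl E"
    and "\<And>S. finite S \<Longrightarrow> separates E A B S \<Longrightarrow> n \<le> card S"
  shows "\<exists>P. linkage E A B {..<n} P"
  using assms
proof (induction "card E" arbitrary: E A B rule: less_induct)
  case (less E A B)
  show ?case
  proof (cases "E = {}")
    case True
    have "n \<le> card (A \<inter> B)" using less.prems(2,5) True by (auto intro: separates_inter)
    then obtain C where C: "C \<subseteq> A \<inter> B" "card C = n" "finite C"
      by (meson obtain_subset_with_card_n)
    then obtain f where f: "bij_betw f {..<n} C"
      by (metis atLeast0LessThan ex_bij_betw_nat_finite)
    have "linkage E A B {..<n} (\<lambda>i. [f i])"
      using f C(1) by (auto simp: linkage_def disjoint_family_on_def bij_betw_def inj_on_def)
    then show ?thesis by blast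
  next
    case False
    then obtain x y where xy: "(x, y) \<in> E" by auto
    define E' where "E' = E - {(x, y)}"
    have E': "finite E'" "irrefl E'" "card E' < card E" "E' \<subseteq> E"
      using less.prems(1,4) card_Diff1_less[OF less.prems(1) xy] by (auto simp: E'_def irrefl_def)
    have "x \<noteq> y" using less.prems(4) xy by (auto simp: irrefl_def)
    show ?thesis
    proof (cases "\<forall>S. finite S \<longrightarrow> separates E' A B S \<longrightarrow> n \<le> card S")
      case True
      then obtain P where "linkage E' A B {..<n} P"
        using less.hyps[OF E'(3,1) less.prems(2,3) E'(2)] by blast
      then show ?thesis using linkage_mono E'(4) by blast
    next
      case False
      then obtain S where S: "finite S" "separates E' A B S" "card S < n" by auto
      have sepx: "separates E A B (insert x S)" and sepy: "separates E A B (insert y S)"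
        using S(2) by (auto simp: E'_def intro!: separates_insert_end)
      have "n \<le> card (insert x S)" "n \<le> card (insert y S)"
        using less.prems(5) sepx sepy S(1) by auto
      then have card: "card (insert x S) = n" "card (insert y S) = n" "x \<notin> S" "y \<notin> S"
        using S(1,3) by (auto simp: card_insert_if split: if_splits)
      have "\<exists>P. linkage E' A (insert x S) {..<n} P"
        using less.prems(2,5) S(1) separates_via_tail[OF sepx]
        by (intro less.hyps E') (auto simp: E'_def)
      then obtain P where P: "linkage E' A (insert x S) (insert x S) P"
        and lastP: "\<And>s. s \<in> insert x S \<Longrightarrow> last (P s) = s"
        using S(1) card(1) by (metis linkage_index_by_last card_lessThan finite_insert)
      have "\<exists>Q. linkage E' (insert y S) B {..<n} Q"
        using less.prems(3,5) S(1) separates_via_head[OF sepy]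
        by (intro less.hyps E') (auto simp: E'_def)
      then obtain Q where Q: "linkage E' (insert y S) B (insert y S) Q"
        and hdQ: "\<And>s. s \<in> insert y S \<Longrightarrow> hd (Q s) = s"
        using S(1) card(2) by (metis linkage_index_by_hd card_lessThan finite_insert)
      have walkP: "rel_walk E' (P s)" "distinct (P s)" "hd (P s) \<in> A" if "s \<in> insert x S" for s
        using P that by (auto simp: linkage_def)
      have walkQ: "rel_walk E' (Q s)" "distinct (Q s)" "last (Q s) \<in> B" if "s \<in> insert y S" for s
        using Q that by (auto simp: linkage_def)
      have lastP_in: "s \<in> set (P s)" if "s \<in> insert x S" for s
        using lastP[OF that] walkP(1)[OF that] by (metis last_in_set rel_walk_def)
      have hdQ_in: "s \<in> set (Q s)" if "s \<in> insert y S" for s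
        using hdQ[OF that] walkQ(1)[OF that] by (metis hd_in_set rel_walk_def)
      have disjP: "s = t" if "s \<in> insert x S" "t \<in> insert x S" "v \<in> set (P s)" "v \<in> set (P t)" for s t v
        using that by (rule linkage_disjoint[OF P])
      have disjQ: "s = t" if "s \<in> insert y S" "t \<in> insert y S" "v \<in> set (Q s)" "v \<in> set (Q t)" for s t v
        using that by (rule linkage_disjoint[OF Q])
      \<comment> \<open>Outside \<open>S\<close> the two linkages cannot meet: a crossing would give a walk from \<open>A\<close> to \<open>B\<close>
        that avoids the separator.\<close>
      have meet: "v = s \<and> v = t" if s: "s \<in> insert x S" and t: "t \<in> insert y S"
        and v: "v \<in> set (P s)" "v \<in> set (Q t)" for s t v
      proof -
        obtain p p' where p: "P s = p @ v # p'" using v(1) by (meson split_list)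
        obtain q q' where q: "Q t = q @ v # q'" using v(2) by (meson split_list)
        have "rel_walk E' (p @ v # q')"
          using walkP(1)[OF s] walkQ(1)[OF t] p q by (metis rel_walk_crossover)
        moreover have "hd (p @ v # q') \<in> A" using walkP(3)[OF s] p by (cases p) auto
        moreover have "last (p @ v # q') \<in> B" using walkQ(3)[OF t] q by simp
        ultimately obtain u where u: "u \<in> set (p @ v # q')" "u \<in> S"
          using separatesD[OF S(2)] by blast
        have "u = v"
        proof (cases "u \<in> set (p @ [v])")
          case True
          then have "u \<in> set (P s)" using p by auto
          then have "u = s" using disjP[of u s u] s u(2) lastP_in[of u] by auto
          then have "u = last (v # p')" using lastP[OF s] p by simp
          then show ?thesis using True walkP(2)[OF s] p by (auto split: if_splits dest: last_in_set)
        next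
          case False
          then have u': "u \<in> set q'" using u(1) by auto
          then have "u \<in> set (Q t)" using q by auto
          then have "u = t" using disjQ[of u t u] t u(2) hdQ_in[of u] by auto
          then have "u = hd (q @ [v])" using hdQ[OF t] q by (cases q) auto
          then show ?thesis using u' walkQ(2)[OF t] q by (cases q) auto
        qed
        then have "v \<in> S" using u by simp
        then show ?thesis
          using disjP[of v s v] disjQ[of v t v] s t v lastP_in[of v] hdQ_in[of v] by auto
      qed
      define g where "g s = (if s = x then y else s)" for s
      define R where "R s = (if s = x then P x @ Q y else P s @ tl (Q s))" for s
      have setR: "set (R s) \<subseteq> set (P s) \<union> set (Q (g s))" for s
        by (cases "Q s") (auto simp: R_def g_def)
      have g: "g s \<in> insert y S" if "s \<in> insert x S" for s using that by (auto simp: g_def)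
      have "linkage E A B (insert x S) R"
        unfolding linkage_def
      proof (intro conjI ballI)
        fix s assume s: "s \<in> insert x S"
        have ne: "P s \<noteq> []" using walkP(1)[OF s] by (simp add: rel_walk_def)
        show "hd (R s) \<in> A" using ne walkP(3)[OF s] by (auto simp: R_def)
        have "rel_walk E (R s) \<and> distinct (R s) \<and> last (R s) \<in> B"
        proof (cases "s = x")
          case True
          have "set (P x) \<inter> set (Q y) = {}" using meet[of x y] \<open>x \<noteq> y\<close> by auto
          moreover have "Q y \<noteq> []" using walkQ(1)[of y] by (simp add: rel_walk_def)
          moreover have "rel_walk E (P x)" "rel_walk E (Q y)"
            using rel_walk_mono[OF _ E'(4)] walkP(1)[of x] walkQ(1)[of y] by auto
          ultimately show ?thesis
            using True ne walkP(2)[of x] walkQ(2,3)[of y] lastP[of x] hdQ[of y] xy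
            by (simp add: R_def rel_walk_append_iff)
        next
          case False
          then have sS: "s \<in> insert y S" using s by auto
          then obtain q where q: "Q s = s # q"
            using hdQ[of s] walkQ(1)[of s] by (cases "Q s") (auto simp: rel_walk_def)
          obtain p where p: "P s = p @ [s]"
            using lastP[OF s] ne by (metis append_butlast_last_id)
          have "rel_walk E' (p @ s # q)"
            using rel_walk_crossover[of E' p s "[]" "[]" q] walkP(1)[OF s] walkQ(1)[OF sS] p q by simp
          moreover have "set (P s) \<inter> set q = {}"
          proof -
            have "v = s" if "v \<in> set (P s)" "v \<in> set q" for v
              using meet[OF s sS that(1)] that(2) q by auto
            then show ?thesis using walkQ(2)[OF sS] q by auto
          qed
          ultimately show ?thesis
            using False p q walkP(2)[OF s] walkQ(2,3)[OF sS] rel_walk_mono[OF _ E'(4)]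
            by (auto simp: R_def)
        qed
        then show "rel_walk E (R s)" "distinct (R s)" "last (R s) \<in> B" by auto
      next
        show "disjoint_family_on (\<lambda>i. set (R i)) (insert x S)"
          unfolding disjoint_family_on_def
        proof (intro ballI impI)
          fix s t assume st: "s \<in> insert x S" "t \<in> insert x S" "s \<noteq> t"
          have gst: "g s \<noteq> g t" using st card(4) by (auto simp: g_def)
          have F: False if v: "v \<in> set (R s)" "v \<in> set (R t)" for v
          proof -
            consider "v \<in> set (P s)" "v \<in> set (P t)" | "v \<in> set (P s)" "v \<in> set (Q (g t))"
              | "v \<in> set (Q (g s))" "v \<in> set (P t)" | "v \<in> set (Q (g s))" "v \<in> set (Q (g t))"
              using v setR by blast
            then show False
            proof cases
              case 1 then show False using disjP st by blast
            next
              case 2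
              then have "v = s" "v = g t" using meet[OF st(1) g[OF st(2)]] by auto
              then show False using st card(3,4) \<open>x \<noteq> y\<close> by (auto simp: g_def split: if_splits)
            next
              case 3
              then have "v = t" "v = g s" using meet[OF st(2) g[OF st(1)]] by auto
              then show False using st card(3,4) \<open>x \<noteq> y\<close> by (auto simp: g_def split: if_splits)
            next
              case 4 then show False using disjQ g st gst by blast
            qed
          qed
          then show "set (R s) \<inter> set (R t) = {}" by blast
        qed
      qed
      moreover obtain f where "bij_betw f {..<n} (insert x S)"
        using card(1) S(1) by (metis atLeast0LessThan ex_bij_betw_nat_finite finite_insert)
      ultimately have "linkage E A B {..<n} (R \<circ> f)"
        by (intro linkage_reindex) (auto simp: bij_betw_def)
      then show ?thesis by blast
    qed
  qed
qed

section \<open>Shortest linkages\<close>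

definition shortest_linkage ::
    "'a rel \<Rightarrow> 'a set \<Rightarrow> 'a set \<Rightarrow> 'i set \<Rightarrow> ('i \<Rightarrow> 'a list) \<Rightarrow> bool" where
  "shortest_linkage E A B I P \<longleftrightarrow> linkage E A B I P \<and>
     (\<forall>Q. linkage E A B I Q \<longrightarrow> (\<Sum>i\<in>I. length (P i)) \<le> (\<Sum>i\<in>I. length (Q i)))"

lemma shortest_linkage_le:
  assumes "shortest_linkage E A B I P" "linkage E A B I Q"
  shows "(\<Sum>i\<in>I. length (P i)) \<le> (\<Sum>i\<in>I. length (Q i))"
  using assms by (simp add: shortest_linkage_def)

lemma ex_shortest_linkage:
  assumes "linkage E A B I P"
  obtains Q where "shortest_linkage E A B I Q"
  using ex_has_least_nat[of "linkage E A B I" P "\<lambda>P. \<Sum>i\<in>I. length (P i)"] assms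
  unfolding shortest_linkage_def by blast

lemma shortest_linkage_reindex:
  assumes "shortest_linkage E A B I P" "bij_betw f I I"
  shows "shortest_linkage E A B I (P \<circ> f)"
proof -
  have "(\<Sum>i\<in>I. length ((P \<circ> f) i)) = (\<Sum>i\<in>I. length (P i))"
    using sum.reindex_bij_betw[OF assms(2), of "\<lambda>i. length (P i)"] by simp
  moreover have "linkage E A B I (P \<circ> f)"
    using assms by (intro linkage_reindex[of E A B I]) (auto simp: shortest_linkage_def bij_betw_def)
  ultimately show ?thesis using assms(1) by (simp add: shortest_linkage_def)
qed

lemma linkageD:
  assumes "linkage E A B I P" "i \<in> I"
  shows "rel_walk E (P i)" "distinct (P i)" "hd (P i) \<in> A" "last (P i) \<in> B" "P i \<noteq> []"
  using assms by (auto simp: linkage_def rel_walk_def)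

lemma rel_walk_take:
  assumes "rel_walk E p" "0 < n"
  shows "rel_walk E (take n p)"
  using assms append_take_drop_id[of n p] successively_append_iff[of _ "take n p" "drop n p"]
  by (auto simp: rel_walk_def)

lemma rel_walk_drop:
  assumes "rel_walk E p" "n < length p"
  shows "rel_walk E (drop n p)"
  using assms append_take_drop_id[of n p] successively_append_iff[of _ "take n p" "drop n p"]
  by (auto simp: rel_walk_def)

lemma disjoint_set_take_drop:
  assumes "distinct p" "m \<le> n"
  shows "set (take m p) \<inter> set (drop n p) = {}"
  using assms by (simp add: set_take_disj_set_drop_if_distinct)

text \<open>
  Otherwise follow each path \<open>a\<close> of \<open>S\<close> up to position \<open>i a\<close> and go on from position \<open>j (f a)\<close> of the
  path \<open>f a\<close>. Since \<open>f\<close> permutes \<open>S\<close>, this is again a linkage between the same two sets, with the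
  ends permuted, and it is shorter because the vertices between \<open>i a\<close> and \<open>j a\<close> are left out.
\<close>

lemma no_cyclic_exchange:
  assumes short: "shortest_linkage E A B I P" and "finite I"
    and S: "S \<subseteq> I" "S \<noteq> {}" and f: "bij_betw f S S"
    and ij: "\<And>a. a \<in> S \<Longrightarrow> i a + 1 < j a" "\<And>a. a \<in> S \<Longrightarrow> j a < length (P a)"
  shows "\<exists>a\<in>S. (P a ! i a, P (f a) ! j (f a)) \<notin> E"
proof (rule ccontr)
  assume "\<not> ?thesis"
  then have arc: "(P a ! i a, P (f a) ! j (f a)) \<in> E" if "a \<in> S" for a using that by blast
  have P: "linkage E A B I P" using short by (simp add: shortest_linkage_def)
  have fS: "f a \<in> S" if "a \<in> S" for a using f that by (auto simp: bij_betw_def)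
  have iS: "i a < length (P a)" if "a \<in> S" for a using ij[OF that] by simp
  have jS: "i a + 1 < j a" "j a < length (P a)" if "a \<in> S" for a using ij[OF that] by auto
  have SI: "a \<in> I" if "a \<in> S" for a using S(1) that by auto
  define g where "g a = (if a \<in> S then f a else a)" for a
  define pre where "pre a = (if a \<in> S then take (i a + 1) (P a) else P a)" for a
  define post where "post a = (if a \<in> S then drop (j a) (P a) else [])" for a
  define Q where "Q a = pre a @ post (g a)" for a
  have gI: "g a \<in> I" if "a \<in> I" for a using that fS S(1) by (auto simp: g_def)
  have g_inj: "a = b" if "g a = g b" "a \<in> I" "b \<in> I" for a b
  proof (cases "a \<in> S \<longleftrightarrow> b \<in> S")
    case True
    then show ?thesis using that(1) f by (auto simp: g_def bij_betw_def dest: inj_onD split: if_splits)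
  next
    case False
    then show ?thesis using that(1) fS[of a] fS[of b] by (auto simp: g_def)
  qed
  have pre: "set (pre a) \<subseteq> set (P a)" for a by (auto simp: pre_def dest: in_set_takeD)
  have post: "set (post a) \<subseteq> set (P a)" for a by (auto simp: post_def dest: in_set_dropD)
  have pre_post: "set (pre a) \<inter> set (post a) = {}" if "a \<in> I" for a
    using disjoint_set_take_drop[OF linkageD(2)[OF P that], of "i a + 1" "j a"] ij(1)[of a]
    by (auto simp: pre_def post_def)
  have "linkage E A B I Q"
    unfolding linkage_def
  proof (intro conjI ballI)
    fix a assume a: "a \<in> I"
    note Pa = linkageD[OF P a]
    have "rel_walk E (Q a) \<and> hd (Q a) \<in> A \<and> last (Q a) \<in> B"
    proof (cases "a \<in> S")
      case True
      have ne: "pre a \<noteq> []" "post (f a) \<noteq> []"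
        using True Pa(5) jS(2)[OF fS[OF True]] fS[OF True] by (auto simp: pre_def post_def)
      have "rel_walk E (pre a)" using True Pa(1) by (simp add: pre_def rel_walk_take)
      moreover have "rel_walk E (post (f a))"
        using jS(2)[OF fS[OF True]] linkageD(1)[OF P SI[OF fS[OF True]]] fS[OF True]
        by (simp add: post_def rel_walk_drop)
      moreover have "last (pre a) = P a ! i a"
        using True iS[OF True] by (simp add: pre_def take_Suc_conv_app_nth)
      moreover have "hd (post (f a)) = P (f a) ! j (f a)"
        using fS[OF True] jS(2)[OF fS[OF True]] by (simp add: post_def hd_drop_conv_nth)
      moreover have "last (post (f a)) = last (P (f a))"
        using fS[OF True] jS(2)[OF fS[OF True]] by (simp add: post_def)
      moreover have "hd (pre a) = hd (P a)" using True by (simp add: pre_def)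
      ultimately show ?thesis
        using ne True arc[OF True] Pa(3) linkageD(4)[OF P SI[OF fS[OF True]]]
        by (simp add: Q_def g_def rel_walk_append_iff)
    next
      case False
      then show ?thesis using Pa by (simp add: Q_def g_def pre_def post_def)
    qed
    then show "rel_walk E (Q a)" "hd (Q a) \<in> A" "last (Q a) \<in> B" by auto
    have "set (pre a) \<inter> set (post (g a)) = {}"
    proof (cases "g a = a")
      case True then show ?thesis using pre_post[OF a] by simp
    next
      case False
      then have "a \<noteq> g a" by simp
      then have "set (P a) \<inter> set (P (g a)) = {}"
        using P a gI[OF a] by (simp add: linkage_def disjoint_family_on_def)
      then show ?thesis using pre[of a] post[of "g a"] by blast
    qed
    moreover have "distinct (pre a)" using Pa(2) by (simp add: pre_def)
    moreover have "distinct (post (g a))" using linkageD(2)[OF P gI[OF a]] by (simp add: post_def)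
    ultimately show "distinct (Q a)" by (simp add: Q_def)
  next
    show "disjoint_family_on (\<lambda>a. set (Q a)) I"
      unfolding disjoint_family_on_def
    proof (intro ballI impI)
      fix a b assume ab: "a \<in> I" "b \<in> I" "a \<noteq> b"
      have disj: "c = d" if "c \<in> I" "d \<in> I" "v \<in> set (P c)" "v \<in> set (P d)" for c d v
        using that by (rule linkage_disjoint[OF P])
      have False if v: "v \<in> set (Q a)" "v \<in> set (Q b)" for v
      proof -
        consider "v \<in> set (pre a)" "v \<in> set (pre b)" | "v \<in> set (pre a)" "v \<in> set (post (g b))"
          | "v \<in> set (post (g a))" "v \<in> set (pre b)" | "v \<in> set (post (g a))" "v \<in> set (post (g b))"
          using v by (auto simp: Q_def)
        then show False
        proof cases
          case 1
          then show False using disj[OF ab(1,2) subsetD[OF pre] subsetD[OF pre]] ab(3) by simp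
        next
          case 2
          then have "a = g b"
            using disj[OF ab(1) gI[OF ab(2)] subsetD[OF pre] subsetD[OF post]] by simp
          then show False using 2 pre_post[OF ab(1)] by auto
        next
          case 3
          then have "b = g a"
            using disj[OF ab(2) gI[OF ab(1)] subsetD[OF pre] subsetD[OF post]] by simp
          then show False using 3 pre_post[OF ab(2)] by auto
        next
          case 4
          then have "g a = g b"
            using disj[OF gI[OF ab(1)] gI[OF ab(2)] subsetD[OF post] subsetD[OF post]] by simp
          then show False using g_inj ab by simp
        qed
      qed
      then show "set (Q a) \<inter> set (Q b) = {}" by blast
    qed
  qed
  moreover have "(\<Sum>a\<in>I. length (Q a)) < (\<Sum>a\<in>I. length (P a))"
  proof -
    have bij: "bij_betw g I I"
    proof -
      have "inj_on g I" using g_inj by (auto simp: inj_on_def)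
      moreover have "g ` I \<subseteq> I" using gI by auto
      ultimately show ?thesis using \<open>finite I\<close> by (simp add: bij_betw_of_inj_into)
    qed
    have "(\<Sum>a\<in>I. length (Q a)) = (\<Sum>a\<in>I. length (pre a)) + (\<Sum>a\<in>I. length (post (g a)))"
      by (simp add: Q_def sum.distrib)
    also have "(\<Sum>a\<in>I. length (post (g a))) = (\<Sum>a\<in>I. length (post a))"
      using sum.reindex_bij_betw[OF bij, of "\<lambda>a. length (post a)"] .
    finally have "(\<Sum>a\<in>I. length (Q a)) = (\<Sum>a\<in>I. length (pre a) + length (post a))"
      by (simp add: sum.distrib)
    also have "\<dots> < (\<Sum>a\<in>I. length (P a))"
    proof (rule sum_strict_mono_ex1[OF \<open>finite I\<close>])
      show "\<forall>a\<in>I. length (pre a) + length (post a) \<le> length (P a)"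
      proof
        fix a
        show "length (pre a) + length (post a) \<le> length (P a)"
          using ij[of a] by (cases "a \<in> S") (auto simp: pre_def post_def)
      qed
      obtain a where "a \<in> S" using S(2) by auto
      then show "\<exists>a\<in>I. length (pre a) + length (post a) < length (P a)"
        using ij[of a] S(1) by (intro bexI[of _ a]) (auto simp: pre_def post_def)
    qed
    finally show ?thesis .
  qed
  ultimately show False using shortest_linkage_le[OF short, of Q] by linarith
qed

lemma no_forward_chord:
  assumes short: "shortest_linkage E A B I P" and "finite I" "a \<in> I"
    and "i + 1 < j" "j < length (P a)"
  shows "(P a ! i, P a ! j) \<notin> E"
proof -
  have "\<exists>b\<in>{a}. (P b ! i, P (id b) ! j) \<notin> E"
    using assms by (intro no_cyclic_exchange[OF short \<open>finite I\<close>]) auto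
  then show ?thesis by simp
qed

text \<open>Iterating \<open>f\<close> shrinks \<open>K\<close> to the set of its periodic points.\<close>

lemma finite_self_map_permutes_subset:
  assumes "finite K" "K \<noteq> {}" "f ` K \<subseteq> K"
  shows "\<exists>S\<subseteq>K. S \<noteq> {} \<and> bij_betw f S S"
  using assms
proof (induction "card K" arbitrary: K rule: less_induct)
  case less
  show ?case
  proof (cases "f ` K = K")
    case True
    then have "bij_betw f K K" using less.prems(1) finite_surj_inj[of K f] by (simp add: bij_betw_def)
    then show ?thesis using less.prems(2) by blast
  next
    case False
    then have "card (f ` K) < card K" using less.prems by (intro psubset_card_mono) auto
    moreover have "f ` (f ` K) \<subseteq> f ` K" using less.prems(3) by (rule image_mono)
    ultimately obtain S where "S \<subseteq> f ` K" "S \<noteq> {}" "bij_betw f S S"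
      using less.hyps[of "f ` K"] less.prems(1,2) by auto
    then show ?thesis using less.prems(3) by (meson order_trans)
  qed
qed

lemma shortest_linkage_source_first:
  assumes short: "shortest_linkage E A B I P" and "finite I" "a \<in> I"
    and t: "t < length (P a)" "P a ! t \<in> A"
  shows "t = 0"
proof (rule ccontr)
  assume "t \<noteq> 0"
  have P: "linkage E A B I P" using short by (simp add: shortest_linkage_def)
  define Q where "Q = P(a := drop t (P a))"
  have sub: "set (Q b) \<subseteq> set (P b)" for b by (auto simp: Q_def dest: in_set_dropD)
  have "linkage E A B I Q"
    unfolding linkage_def
  proof (intro conjI ballI)
    show "disjoint_family_on (\<lambda>b. set (Q b)) I"
      using P sub unfolding linkage_def disjoint_family_on_def by blast
  qed (use linkageD[OF P] t in \<open>auto simp: Q_def rel_walk_drop hd_drop_conv_nth\<close>)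
  moreover have "(\<Sum>b\<in>I. length (Q b)) < (\<Sum>b\<in>I. length (P b))"
    using \<open>finite I\<close> \<open>a \<in> I\<close> t \<open>t \<noteq> 0\<close>
    by (intro sum_strict_mono_ex1) (auto simp: Q_def intro!: bexI[of _ a])
  ultimately show False using shortest_linkage_le[OF short, of Q] by linarith
qed

text \<open>Otherwise \<open>p\<close> is a shorter way to position \<open>t\<close> of the path \<open>a\<close> than its own beginning.\<close>

lemma shortest_linkage_entry:
  assumes short: "shortest_linkage E A B I P" and "finite I" "a \<in> I"
    and p: "rel_walk E p" "distinct p" "hd p \<in> A" "\<And>b. b \<in> I \<Longrightarrow> set p \<inter> set (P b) = {}"
    and t: "t < length (P a)" "(last p, P a ! t) \<in> E"
  shows "t \<le> length p"
proof (rule ccontr)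
  assume "\<not> t \<le> length p"
  have P: "linkage E A B I P" using short by (simp add: shortest_linkage_def)
  have ne: "p \<noteq> []" using p(1) by (simp add: rel_walk_def)
  define Q where "Q = P(a := p @ drop t (P a))"
  have sub: "set (Q b) \<subseteq> set (P b) \<union> (if b = a then set p else {})" for b
    by (auto simp: Q_def dest: in_set_dropD)
  have "linkage E A B I Q"
    unfolding linkage_def
  proof (intro conjI ballI)
    show "disjoint_family_on (\<lambda>b. set (Q b)) I"
      unfolding disjoint_family_on_def
    proof (intro ballI impI)
      fix b c assume "b \<in> I" "c \<in> I" "b \<noteq> c"
      moreover from this have "set (P b) \<inter> set (P c) = {}"
        using P by (simp add: linkage_def disjoint_family_on_def)
      ultimately show "set (Q b) \<inter> set (Q c) = {}"
        using sub[of b] sub[of c] p(4)[of b] p(4)[of c]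
        by (cases "b = a"; cases "c = a"; simp; blast)
    qed
    fix b assume b: "b \<in> I"
    show "rel_walk E (Q b)"
      using linkageD(1)[OF P b] p(1) t ne
      by (auto simp: Q_def rel_walk_append_iff rel_walk_drop hd_drop_conv_nth)
    show "distinct (Q b)"
      using linkageD(2)[OF P b] p(2) p(4)[OF b] by (auto simp: Q_def dest: in_set_dropD)
    show "hd (Q b) \<in> A" using linkageD(3)[OF P b] p(3) ne by (auto simp: Q_def)
    show "last (Q b) \<in> B" using linkageD(4)[OF P b] t by (auto simp: Q_def)
  qed
  moreover have "(\<Sum>b\<in>I. length (Q b)) < (\<Sum>b\<in>I. length (P b))"
    using \<open>finite I\<close> \<open>a \<in> I\<close> t \<open>\<not> t \<le> length p\<close>
    by (intro sum_strict_mono_ex1) (auto simp: Q_def intro!: bexI[of _ a])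
  ultimately show False using shortest_linkage_le[OF short, of Q] by linarith
qed

section \<open>Choosing blocks on the columns\<close>

text \<open>
  The paths \<open>P\<close> are the columns, and \<open>j \<in> J\<close> stands for a block at position \<open>pos j\<close> of the column
  \<open>c j\<close>. A bridge leads from a vertex below the block \<open>j\<close>, itself not a block, to the vertex right
  above the block \<open>i\<close>. The bound \<open>n\<close> keeps bridges clear of the blocks that a greedy choice has
  fixed before.
\<close>

definition bridged ::
    "'a rel \<Rightarrow> ('i \<Rightarrow> 'a list) \<Rightarrow> ('j \<Rightarrow> 'i) \<Rightarrow> ('j \<Rightarrow> nat) \<Rightarrow> 'j set \<Rightarrow> nat \<Rightarrow> 'j \<Rightarrow> 'j \<Rightarrow> bool" where
  "bridged E P c pos J n i j \<longleftrightarrow>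
     (\<exists>y\<ge>n. y < pos j \<and> (\<forall>l\<in>J. c l = c j \<longrightarrow> pos l \<noteq> y) \<and>
        (P (c j) ! y, P (c i) ! (pos i + 1)) \<in> E)"

text \<open>
  Read \<open>M a\<close> as a tentative block position on \<open>a\<close> and \<open>M b + 4\<close> as a lower bound for the later
  block positions on \<open>b\<close>. If every column had an arc from right above its tentative block to right
  below the later blocks of some other column, then following these arcs would lead to a cyclic
  exchange. It makes the columns shorter because the position \<open>M a + 2\<close> is left out; this is why
  positions are spaced by four.
\<close>

lemma ex_column_below_others:
  assumes short: "shortest_linkage E A B K P" and "finite K" and C: "C \<subseteq> K" "C \<noteq> {}"
    and len: "\<And>a. a \<in> C \<Longrightarrow> M a + 3 < length (P a)"
  shows "\<exists>a\<in>C. \<forall>b\<in>C. b \<noteq> a \<longrightarrow> (P a ! (M a + 1), P b ! (M b + 3)) \<notin> E"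
proof (rule ccontr)
  assume "\<not> ?thesis"
  then have "\<forall>a\<in>C. \<exists>b. b \<in> C \<and> (P a ! (M a + 1), P b ! (M b + 3)) \<in> E" by blast
  from bchoice[OF this]
  obtain f where f: "\<forall>a\<in>C. f a \<in> C \<and> (P a ! (M a + 1), P (f a) ! (M (f a) + 3)) \<in> E" by blast
  then have "f ` C \<subseteq> C" by auto
  then obtain S where S: "S \<subseteq> C" "S \<noteq> {}" "bij_betw f S S"
    using finite_self_map_permutes_subset[of C f] finite_subset[OF C(1) \<open>finite K\<close>] C(2) by auto
  have "\<exists>a\<in>S. (P a ! (M a + 1), P (f a) ! (M (f a) + 3)) \<notin> E"
    using S C(1) len by (intro no_cyclic_exchange[OF short \<open>finite K\<close>]) auto
  then show False using f S(1) by auto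
qed

text \<open>
  The blocks are chosen greedily from bottom to top. With \<open>M a\<close> the lowest position that is still
  available on the column \<open>a\<close>, the previous lemma gives a column \<open>a\<close> such that for every other
  column \<open>b\<close> there is no arc from position \<open>M a + 1\<close> of \<open>a\<close> to position \<open>M b + 3\<close> of \<open>b\<close>. So the
  reverse arc is present, and it is a bridge from below every later block on \<open>b\<close> to the vertex above
  the block at \<open>M a\<close>. On each column the positions below \<open>M b + 4\<close> are then given up, which costs
  every remaining index at most four positions per round.
\<close>

lemma choose_bridged_positions:
  fixes lo :: "'i \<Rightarrow> nat" and c :: "'j \<Rightarrow> 'i"
  assumes short: "shortest_linkage E A B K P" and "finite K"
    and semi: "\<And>a b u v. \<lbrakk>a \<in> K; b \<in> K; u \<in> set (P a); v \<in> set (P b); u \<noteq> v\<rbrakk>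
                  \<Longrightarrow> (u, v) \<in> E \<or> (v, u) \<in> E"
    and "finite J" "c ` J \<subseteq> K"
    and "\<And>j. j \<in> J \<Longrightarrow> R j \<subseteq> {lo (c j)..<length (P (c j))}"
    and "\<And>j. j \<in> J \<Longrightarrow> 4 * card J < card (R j)"
  shows "\<exists>pos. (\<forall>j\<in>J. pos j \<in> R j) \<and>
      (\<forall>i\<in>J. \<forall>j\<in>J. i \<noteq> j \<longrightarrow> c i = c j \<longrightarrow> pos i \<noteq> pos j) \<and>
      (\<forall>i\<in>J. \<forall>j\<in>J. c i \<noteq> c j \<longrightarrow>
         bridged E P c pos J (lo (c j)) i j \<or> bridged E P c pos J (lo (c i)) j i)"
  using assms(4-7)
proof (induction "card J" arbitrary: J R lo)
  case 0
  then show ?case by auto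
next
  case (Suc n J R lo)
  have P: "linkage E A B K P" using short by (simp add: shortest_linkage_def)
  define M where "M a = Min (\<Union>j\<in>{j\<in>J. c j = a}. R j)" for a
  have finR: "finite (R j)" if "j \<in> J" for j
    using Suc.prems(3)[OF that] by (rule finite_subset) simp
  have fin: "finite (\<Union>j\<in>{j\<in>J. c j = a}. R j)" for a
    using Suc.prems(1) finR by auto
  have M_le: "M (c j) \<le> t" if "j \<in> J" "t \<in> R j" for j t
    unfolding M_def using that fin[of "c j"] by (intro Min_le) auto
  have M_in: "\<exists>i\<in>J. c i = a \<and> M a \<in> R i" if a: "a \<in> c ` J" for a
  proof -
    obtain j where j: "j \<in> J" "c j = a" using a by auto
    then have "R j \<noteq> {}" using Suc.prems(4)[OF j(1)] by auto
    then have "(\<Union>j\<in>{j\<in>J. c j = a}. R j) \<noteq> {}" using j by auto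
    from Min_in[OF fin this] show ?thesis by (auto simp: M_def)
  qed
  define R' where "R' j = R j \<inter> {M (c j) + 4..}" for j
  have card_R': "card (R j) \<le> card (R' j) + 4" if "j \<in> J" for j
  proof -
    have "R j \<subseteq> R' j \<union> {M (c j)..<M (c j) + 4}" using M_le[OF that] by (auto simp: R'_def)
    then have "card (R j) \<le> card (R' j \<union> {M (c j)..<M (c j) + 4})"
      using finR[OF that] by (intro card_mono) (auto simp: R'_def)
    also have "\<dots> \<le> card (R' j) + card {M (c j)..<M (c j) + 4}" by (rule card_Un_le)
    finally show ?thesis by simp
  qed
  have len: "M a + 4 < length (P a)" if a: "a \<in> c ` J" for a
  proof -
    obtain j where j: "j \<in> J" "c j = a" using a by auto
    have "0 < card (R' j)" using card_R'[OF j(1)] Suc.prems(4)[OF j(1)] Suc.hyps(2) by simp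
    then obtain t where "t \<in> R' j" by (auto simp: card_gt_0_iff)
    then show ?thesis using Suc.prems(3)[OF j(1)] j(2) by (auto simp: R'_def)
  qed
  have lo_M: "lo a \<le> M a" if a: "a \<in> c ` J" for a
    using M_in[OF a] Suc.prems(3) by fastforce
  have "J \<noteq> {}" using Suc.hyps(2) by auto
  then have "\<exists>a\<in>c ` J. \<forall>b\<in>c ` J. b \<noteq> a \<longrightarrow> (P a ! (M a + 1), P b ! (M b + 3)) \<notin> E"
    using Suc.prems(2) len
    by (intro ex_column_below_others[OF short \<open>finite K\<close>]) fastforce+
  then obtain a where a: "a \<in> c ` J"
    and low: "\<And>b. b \<in> c ` J \<Longrightarrow> b \<noteq> a \<Longrightarrow> (P a ! (M a + 1), P b ! (M b + 3)) \<notin> E" by auto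
  obtain i where i: "i \<in> J" "c i = a" "M a \<in> R i" using M_in[OF a] by auto
  define J' where "J' = J - {i}"
  have J': "finite J'" "c ` J' \<subseteq> K" "n = card J'" "J = insert i J'" "i \<notin> J'"
    using Suc.prems(1,2) Suc.hyps(2) i(1) by (auto simp: J'_def)
  have R'_sub: "R' j \<subseteq> {M (c j) + 4..<length (P (c j))}" if "j \<in> J'" for j
    using Suc.prems(3)[of j] that J'(4) by (auto simp: R'_def)
  have R'_card: "4 * card J' < card (R' j)" if "j \<in> J'" for j
  proof -
    have "j \<in> J" using that J'(4) by simp
    then show ?thesis using Suc.prems(4)[of j] card_R'[of j] Suc.hyps(2) J'(3) by simp
  qed
  obtain pos' where pos'_in: "\<And>j. j \<in> J' \<Longrightarrow> pos' j \<in> R' j"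
    and pos'_eq: "\<And>i j. \<lbrakk>i \<in> J'; j \<in> J'; i \<noteq> j; c i = c j\<rbrakk> \<Longrightarrow> pos' i \<noteq> pos' j"
    and pos'_neq: "\<And>i j. \<lbrakk>i \<in> J'; j \<in> J'; c i \<noteq> c j\<rbrakk> \<Longrightarrow>
         bridged E P c pos' J' (M (c j) + 4) i j \<or> bridged E P c pos' J' (M (c i) + 4) j i"
    using Suc.hyps(1)[OF J'(3) J'(1,2), of R' "\<lambda>b. M b + 4"] R'_sub R'_card by blast
  define pos where "pos = pos'(i := M a)"
  have pos_i: "pos i = M a" and pos_J': "\<And>j. j \<in> J' \<Longrightarrow> pos j = pos' j"
    using J'(5) by (auto simp: pos_def)
  have ge: "M (c j) + 4 \<le> pos j" if "j \<in> J'" for j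
    using pos'_in[OF that] pos_J'[OF that] by (simp add: R'_def)
  have old: "bridged E P c pos J (lo (c j)) l j"
    if lj: "l \<in> J'" "j \<in> J'" and bri: "bridged E P c pos' J' (M (c j) + 4) l j" for l j
  proof -
    obtain y where y: "y \<ge> M (c j) + 4" "y < pos' j" "\<forall>m\<in>J'. c m = c j \<longrightarrow> pos' m \<noteq> y"
      "(P (c j) ! y, P (c l) ! (pos' l + 1)) \<in> E" using bri by (auto simp: bridged_def)
    have "\<forall>m\<in>J. c m = c j \<longrightarrow> pos m \<noteq> y"
      using y(1,3) J'(4) pos_i pos_J' i(2) by auto
    moreover have "lo (c j) \<le> y" using lo_M[of "c j"] y(1) lj(2) J'(4) by auto
    ultimately show ?thesis using y(2,4) pos_J' lj by (auto simp: bridged_def)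
  qed
  have new: "bridged E P c pos J (lo (c j)) i j" if j: "j \<in> J'" "c j \<noteq> a" for j
  proof -
    have cj: "c j \<in> c ` J" using j(1) J'(4) by auto
    have K: "a \<in> K" "c j \<in> K" using Suc.prems(2) a cj by auto
    have in_a: "P a ! (M a + 1) \<in> set (P a)" using len[OF a] by simp
    have in_b: "P (c j) ! (M (c j) + 3) \<in> set (P (c j))" using len[OF cj] by simp
    have "P a ! (M a + 1) \<noteq> P (c j) ! (M (c j) + 3)"
      using linkage_disjoint[OF P K] in_a in_b j(2) by metis
    then have "(P (c j) ! (M (c j) + 3), P a ! (M a + 1)) \<in> E"
      using semi[OF K in_a in_b] low[OF cj j(2)] by blast
    moreover have "\<forall>l\<in>J. c l = c j \<longrightarrow> pos l \<noteq> M (c j) + 3"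
    proof (intro ballI impI)
      fix l assume l: "l \<in> J" "c l = c j"
      then have "l \<in> J'" using i(2) j(2) J'(4) by auto
      then show "pos l \<noteq> M (c j) + 3" using ge[of l] l(2) by simp
    qed
    ultimately show ?thesis
      unfolding bridged_def using ge[OF j(1)] lo_M[OF cj] i(2) pos_i
      by (intro exI[of _ "M (c j) + 3"]) simp
  qed
  show ?case
  proof (intro exI[of _ pos] conjI ballI impI)
    show "pos j \<in> R j" if "j \<in> J" for j
      using that J'(4) pos_i pos_J' i(3) pos'_in by (auto simp: R'_def)
  next
    fix l j assume lj: "l \<in> J" "j \<in> J" "l \<noteq> j" "c l = c j"
    consider "l \<in> J'" "j \<in> J'" | "l = i" "j \<in> J'" | "l \<in> J'" "j = i" using lj J'(4) by auto
    then show "pos l \<noteq> pos j"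
    proof cases
      case 1 then show ?thesis using pos'_eq[OF 1 lj(3,4)] pos_J' by simp
    next
      case 2 then show ?thesis using ge[of j] pos_i i(2) lj(4) by simp
    next
      case 3 then show ?thesis using ge[of l] pos_i i(2) lj(4) by simp
    qed
  next
    fix l j assume lj: "l \<in> J" "j \<in> J" "c l \<noteq> c j"
    consider "l \<in> J'" "j \<in> J'" | "l = i" "j \<in> J'" | "l \<in> J'" "j = i" using lj J'(4) by auto
    then show "bridged E P c pos J (lo (c j)) l j \<or> bridged E P c pos J (lo (c l)) j l"
    proof cases
      case 1 then show ?thesis using pos'_neq[OF 1 lj(3)] old by blast
    next
      case 2 then show ?thesis using new[of j] i(2) lj(3) by simp
    next
      case 3 then show ?thesis using new[of l] i(2) lj(3) by simp
    qed
  qed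
qed

section \<open>The hub\<close>

locale semicomplete_relation =
  fixes V :: "'a set" and E :: "'a rel"
  assumes finite_vertices: "finite V"
    and arcs_subset: "E \<subseteq> V \<times> V"
    and no_loop: "(v, v) \<notin> E"
    and comparable: "\<lbrakk>u \<in> V; v \<in> V; u \<noteq> v\<rbrakk> \<Longrightarrow> (u, v) \<in> E \<or> (v, u) \<in> E"
begin

lemma finite_arcs: "finite E"
  using arcs_subset finite_vertices by (meson finite_SigmaI finite_subset)

lemma out_nbrs_subset: "E `` {v} \<subseteq> V"
  using arcs_subset by auto

definition non_in_nbrs :: "'a \<Rightarrow> 'a set" where
  "non_in_nbrs w = {u \<in> V. u \<noteq> w \<and> (u, w) \<notin> E}"

lemma finite_non_in_nbrs: "finite (non_in_nbrs w)"
  using finite_vertices by (simp add: non_in_nbrs_def)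

text \<open>Of two vertices at most one is a non-in-neighbour of the other, so averaging works.\<close>

lemma ex_few_non_in_nbrs_within:
  assumes "R \<subseteq> V" "R \<noteq> {}"
  shows "\<exists>a\<in>R. 2 * card (non_in_nbrs a \<inter> R) < card R"
proof (rule ccontr)
  assume "\<not> ?thesis"
  then have ge: "card R \<le> 2 * card (non_in_nbrs a \<inter> R)" if "a \<in> R" for a using that by force
  have finR: "finite R" using assms(1) finite_vertices by (rule finite_subset)
  define T where "T = Sigma R (\<lambda>a. non_in_nbrs a \<inter> R)"
  have finT: "finite T" using finR by (auto simp: T_def)
  have "card R * card R \<le> (\<Sum>a\<in>R. 2 * card (non_in_nbrs a \<inter> R))"
    using sum_mono[of R "\<lambda>_. card R"] ge by simp
  also have "\<dots> = 2 * card T"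
    using finR by (simp add: T_def sum_distrib_left)
  also have "\<dots> = card (T \<union> T\<inverse>)"
  proof -
    have "T \<inter> T\<inverse> = {}" using assms(1) comparable by (fastforce simp: T_def non_in_nbrs_def)
    then show ?thesis using finT by (simp add: card_Un_disjoint)
  qed
  also have "\<dots> < card (R \<times> R)"
  proof (rule psubset_card_mono)
    obtain r where "r \<in> R" using assms(2) by auto
    then have "(r, r) \<in> R \<times> R" "(r, r) \<notin> T \<union> T\<inverse>" by (auto simp: T_def non_in_nbrs_def)
    moreover have "T \<union> T\<inverse> \<subseteq> R \<times> R" by (auto simp: T_def)
    ultimately show "T \<union> T\<inverse> \<subset> R \<times> R" by blast
  qed (use finR in simp)
  finally show False by (simp add: card_cartesian_product)
qed

text \<open>
  If there is no such walk, then the out-neighbours \<open>R\<close> of \<open>v\<close> outside \<open>S\<close> are non-in-neighbours of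
  \<open>w\<close>, and so are the out-neighbours of \<open>R\<close> outside \<open>S\<close>. Some \<open>a\<close> in \<open>R\<close> has fewer than half of \<open>R\<close>
  among its non-in-neighbours, and outside \<open>R\<close> and \<open>S\<close> it only has non-in-neighbours of \<open>w\<close>. As \<open>R\<close>
  is at least twice as large as \<open>S\<close>, this gives \<open>a\<close> fewer non-in-neighbours than \<open>w\<close> has.
\<close>

lemma short_walk_to_hub:
  assumes v: "v \<noteq> w" and w: "w \<in> V" "w \<in> S" and "finite S"
    and hub: "\<And>u. u \<in> V - S \<Longrightarrow> card (non_in_nbrs w) \<le> card (non_in_nbrs u)"
    and deg: "3 * card S \<le> card (E `` {v})"
  shows "\<exists>p. length p \<le> 2 \<and> distinct p \<and> set p \<inter> S = {} \<and> rel_walk E (v # p @ [w])"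
proof (rule ccontr)
  assume "\<not> ?thesis"
  then have none: "\<not> rel_walk E (v # p @ [w])"
    if "length p \<le> 2" "distinct p" "set p \<inter> S = {}" for p using that by blast
  define R where "R = E `` {v} - S"
  define B where "B = non_in_nbrs w"
  have RV: "R \<subseteq> V" using out_nbrs_subset by (auto simp: R_def)
  have finR: "finite R" using RV finite_vertices by (rule finite_subset)
  have "card S > 0" using w(2) \<open>finite S\<close> by (auto simp: card_gt_0_iff)
  moreover have "card (E `` {v}) - card S \<le> card R"
    unfolding R_def using \<open>finite S\<close> by (rule diff_card_le_card_Diff)
  ultimately have cardR: "2 * card S \<le> card R" "R \<noteq> {}" using deg by auto
  have Rw: "(a, w) \<notin> E" if "a \<in> R" for a
  proof
    assume "(a, w) \<in> E"
    then have "rel_walk E (v # [a] @ [w])" using that by (auto simp: rel_walk_def R_def)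
    then show False using none[of "[a]"] that by (auto simp: R_def)
  qed
  then have RB: "R \<subseteq> B" using RV w(2) by (auto simp: B_def non_in_nbrs_def R_def)
  obtain a where a: "a \<in> R" "2 * card (non_in_nbrs a \<inter> R) < card R"
    using ex_few_non_in_nbrs_within[OF RV cardR(2)] by auto
  have aB: "non_in_nbrs a - S \<subseteq> B"
  proof
    fix u assume u: "u \<in> non_in_nbrs a - S"
    then have au: "(a, u) \<in> E" "u \<noteq> a" "u \<in> V" "u \<notin> S"
      using comparable[of a u] a(1) RV by (auto simp: non_in_nbrs_def)
    have "(u, w) \<notin> E"
    proof
      assume "(u, w) \<in> E"
      then have "rel_walk E (v # [a, u] @ [w])" using au a(1) by (auto simp: rel_walk_def R_def)
      then show False using none[of "[a, u]"] au a(1) by (auto simp: R_def)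
    qed
    then show "u \<in> B" using au w(2) by (auto simp: B_def non_in_nbrs_def)
  qed
  have "card B \<le> card (non_in_nbrs a)"
    using hub[of a] a(1) RV by (auto simp: B_def R_def)
  also have "non_in_nbrs a \<subseteq> S \<union> (B - R) \<union> (non_in_nbrs a \<inter> R)" using aB by auto
  then have "card (non_in_nbrs a) \<le> card (S \<union> (B - R) \<union> (non_in_nbrs a \<inter> R))"
    using \<open>finite S\<close> finR by (intro card_mono) (auto simp: B_def finite_non_in_nbrs)
  also have "\<dots> \<le> card S + card (B - R) + card (non_in_nbrs a \<inter> R)"
    by (meson add_le_mono1 card_Un_le le_trans)
  finally have "card B \<le> card S + card (B - R) + card (non_in_nbrs a \<inter> R)" .
  moreover have "card (B - R) = card B - card R" using RB finR by (rule card_Diff_subset[rotated])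
  moreover have "card R \<le> card B" using RB by (intro card_mono) (auto simp: B_def finite_non_in_nbrs)
  ultimately show False using a(2) cardR(1) by linarith
qed

section \<open>Linkages that avoid the blocks\<close>

text \<open>
  Let \<open>C\<close> be a set of fewer than \<open>k\<close> vertices that separates \<open>W\<close> from \<open>Y\<close> once \<open>X\<close> and the blocks
  \<open>Z\<close> are gone, and let \<open>A\<close> be the set of vertices that can still be reached from \<open>W\<close>. Of the \<open>k + 1\<close>
  columns at least two avoid \<open>C\<close>. On a column whose end is not reached, the first vertex that is
  neither reached nor a block lies right above a block. If this happens on two columns, a bridge
  reaches one of these two vertices. So one of the columns is reached up to its end, which is not in
  \<open>Y\<close> and hence is \<open>e\<close>. On the other column, everything above the last block is unreached, and it
  dominates all of \<open>A\<close>, while \<open>e\<close> has all its out-neighbours in \<open>A\<close>, \<open>C\<close>, \<open>Z\<close> and \<open>X\<close>. There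
  are at least \<open>3 * k\<close> vertices between the last block and the last vertex before the end of that
  column. That vertex also dominates all of them but its predecessor, so its out-degree exceeds that
  of \<open>e\<close>.
\<close>

lemma linkage_avoiding_blocks:
  fixes c :: "'j \<Rightarrow> 'i" and P :: "'i \<Rightarrow> 'a list"
  assumes short: "shortest_linkage (Restr E (V - X)) W (insert e Y) K P"
    and K: "finite K" "card K = k + 1"
    and XY: "X \<subseteq> V" "card X \<le> k" "Y \<subseteq> V - X" "card Y = k"
    and W: "W \<subseteq> V - X"
    and e: "e \<in> V - X - Y" "\<And>v. v \<in> V - X - Y \<Longrightarrow> card (E `` {v}) \<le> card (E `` {e})"
    and Z: "Z \<subseteq> V - X" "card Z \<le> k" "Z \<inter> W = {}" "Z \<inter> insert e Y = {}"
    and blocks: "\<And>a t. \<lbrakk>a \<in> K; t < length (P a); P a ! t \<in> Z\<rbrakk> \<Longrightarrow> \<exists>j\<in>J. c j = a \<and> pos j = t"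
    and low: "\<And>j. j \<in> J \<Longrightarrow> pos j + (3 * k + 3) \<le> length (P (c j))"
    and bridges: "\<And>i j. \<lbrakk>i \<in> J; j \<in> J; c i \<noteq> c j\<rbrakk> \<Longrightarrow>
        bridged (Restr E (V - X)) P c pos J 0 i j \<or> bridged (Restr E (V - X)) P c pos J 0 j i"
  shows "\<exists>Q. linkage (Restr E (V - X - Z)) W Y {..<k} Q"
proof (rule menger)
  let ?F = "Restr E (V - X - Z)"
  have finV: "finite U" if "U \<subseteq> V" for U using that finite_vertices by (rule finite_subset)
  show "finite ?F" using finite_arcs by simp
  show "finite W" "finite Y" using W XY(3) by (auto intro: finV)
  show "irrefl ?F" using no_loop by (auto simp: irrefl_def)
  fix C assume C: "finite C" "separates ?F W Y C"
  show "k \<le> card C"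
  proof (rule ccontr)
    assume "\<not> k \<le> card C"
    then have cardC: "card C < k" by simp
    define A where "A = {v. \<exists>p. rel_walk ?F p \<and> hd p \<in> W \<and> last p = v \<and> set p \<inter> C = {}}"
    have P: "linkage (Restr E (V - X)) W (insert e Y) K P" using short by (simp add: shortest_linkage_def)
    have WU: "W \<subseteq> V - X - Z" using W Z(3) by auto
    have AU: "A \<subseteq> V - X - Z"
    proof
      fix v assume "v \<in> A"
      then obtain p where p: "rel_walk ?F p" "hd p \<in> W" "last p = v" by (auto simp: A_def)
      then have "set p \<subseteq> V - X - Z" using WU by (intro rel_walk_subset[of ?F]) auto
      moreover have "last p \<in> set p" using p(1) by (simp add: rel_walk_def)
      ultimately show "v \<in> V - X - Z" using p(3) by auto
    qed
    have WA: "w \<in> A" if "w \<in> W" "w \<notin> C" for w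
      using that by (auto simp: A_def intro!: exI[of _ "[w]"])
    have step: "u \<in> A" if v: "v \<in> A" and vu: "(v, u) \<in> E" "u \<in> V - X - Z" "u \<notin> C" for v u
    proof -
      obtain p where p: "rel_walk ?F p" "hd p \<in> W" "last p = v" "set p \<inter> C = {}"
        using v by (auto simp: A_def)
      have "p \<noteq> []" using p(1) by (simp add: rel_walk_def)
      moreover have "(v, u) \<in> ?F" using vu v AU by auto
      ultimately have "rel_walk ?F (p @ [u]) \<and> hd (p @ [u]) \<in> W \<and> last (p @ [u]) = u \<and> set (p @ [u]) \<inter> C = {}"
        using p vu(3) by (simp add: rel_walk_append_iff)
      then show ?thesis unfolding A_def by blast
    qed
    have AY: "A \<inter> Y = {}" using separatesD[OF C(2)] by (fastforce simp: A_def)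
    have Pin: "P a ! t \<in> V - X" if at: "a \<in> K" "t < length (P a)" for a t
    proof -
      have "set (P a) \<subseteq> V - X"
        using linkageD[OF P at(1)] W by (intro rel_walk_subset[of "Restr E (V - X)"]) auto
      then show ?thesis using nth_mem[OF at(2)] by blast
    qed
    have Parc: "(P a ! t, P a ! Suc t) \<in> E" if at: "a \<in> K" "Suc t < length (P a)" for a t
      using linkageD(1)[OF P at(1)] at(2) by (auto simp: rel_walk_def dest: successively_nth)
    define K' where "K' = {a \<in> K. set (P a) \<inter> C = {}}"
    have "\<exists>g. \<forall>a\<in>K - K'. g a \<in> set (P a) \<inter> C"
      by (rule bchoice) (auto simp: K'_def)
    then obtain g where g: "\<And>a. a \<in> K - K' \<Longrightarrow> g a \<in> set (P a) \<inter> C" by auto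
    have "card (K - K') \<le> card C"
    proof (rule card_inj_on_le[of g])
      show "inj_on g (K - K')"
      proof (rule inj_onI)
        fix a b assume ab: "a \<in> K - K'" "b \<in> K - K'" "g a = g b"
        then show "a = b" using linkage_disjoint[OF P, of a b "g a"] g[of a] g[of b] by auto
      qed
      show "g ` (K - K') \<subseteq> C" using g by auto
    qed (rule C(1))
    moreover have "card (K - K') = card K - card K'"
      using K(1) by (intro card_Diff_subset) (auto simp: K'_def)
    ultimately have "2 \<le> card K'" using K(2) cardC by simp
    then obtain T where "T \<subseteq> K'" "card T = 2" by (rule obtain_subset_with_card_n)
    then obtain a b where ab: "a \<in> K'" "b \<in> K'" "a \<noteq> b" by (auto simp: card_2_iff)
    have K'D: "d \<in> K" "\<And>t. t < length (P d) \<Longrightarrow> P d ! t \<notin> C" if "d \<in> K'" for d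
      using that by (auto simp: K'_def disjoint_iff)
    have last_notZ: "last (P d) \<notin> Z" if "d \<in> K" for d using linkageD(4)[OF P that] Z(4) by auto
    have first_block: "\<exists>j\<in>J. c j = d \<and> P d ! (pos j + 1) \<notin> A \<and> pos j + 1 < length (P d) \<and>
        P d ! (pos j + 1) \<notin> Z \<and> (\<forall>t\<le>pos j. P d ! t \<in> A \<union> Z)"
      if d: "d \<in> K'" "last (P d) \<notin> A" for d
    proof -
      note dK = K'D[OF d(1)]
      define bad where "bad t \<longleftrightarrow> t < length (P d) \<and> P d ! t \<notin> A \<union> Z" for t
      define t where "t = Least bad"
      have "P d \<noteq> []" using linkageD(5)[OF P dK(1)] .
      then have "bad (length (P d) - 1)"
        using d(2) last_notZ[OF dK(1)] by (simp add: bad_def last_conv_nth)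
      then have t: "bad t" and less: "\<And>s. s < t \<Longrightarrow> \<not> bad s"
        unfolding t_def by (auto intro: LeastI dest: not_less_Least)
      have "P d ! 0 \<in> A"
        using WA[of "P d ! 0"] dK(2)[of 0] linkageD(3,5)[OF P dK(1)] by (simp add: hd_conv_nth)
      then have "t \<noteq> 0" using t unfolding bad_def by (metis UnI1)
      then obtain s where s: "t = Suc s" by (cases t) auto
      have len: "s < length (P d)" "Suc s < length (P d)" using t s by (auto simp: bad_def)
      have before: "P d ! r \<in> A \<union> Z" if "r \<le> s" for r
        using less[of r] that s len by (auto simp: bad_def)
      have "P d ! s \<notin> A"
        using step[OF _ Parc[OF dK(1) len(2)]] Pin[OF dK(1) len(2)] dK(2)[OF len(2)] t s
        by (auto simp: bad_def)
      then have "P d ! s \<in> Z" using before by auto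
      then obtain j where "j \<in> J" "c j = d" "pos j = s" using blocks[OF dK(1) len(1)] by auto
      then show ?thesis using before t s len by (intro bexI[of _ j]) (auto simp: bad_def)
    qed
    have no_two: False
      if d: "d \<in> K'" "last (P d) \<notin> A" and f: "f \<in> K'" "last (P f) \<notin> A" and "d \<noteq> f" for d f
    proof -
      obtain i where i: "i \<in> J" "c i = d" "P d ! (pos i + 1) \<notin> A" "pos i + 1 < length (P d)"
        "P d ! (pos i + 1) \<notin> Z" "\<forall>t\<le>pos i. P d ! t \<in> A \<union> Z" using first_block[OF d] by auto
      obtain j where j: "j \<in> J" "c j = f" "P f ! (pos j + 1) \<notin> A" "pos j + 1 < length (P f)"
        "P f ! (pos j + 1) \<notin> Z" "\<forall>t\<le>pos j. P f ! t \<in> A \<union> Z" using first_block[OF f] by auto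
      have nobridge: "\<not> bridged (Restr E (V - X)) P c pos J 0 l m"
        if lm: "c l \<in> K'" "c m \<in> K'" "P (c l) ! (pos l + 1) \<notin> A" "pos l + 1 < length (P (c l))"
          "P (c l) ! (pos l + 1) \<notin> Z" "pos m + 1 < length (P (c m))"
          "\<forall>t\<le>pos m. P (c m) ! t \<in> A \<union> Z" for l m
      proof
        assume "bridged (Restr E (V - X)) P c pos J 0 l m"
        then obtain y where y: "y < pos m" "\<forall>r\<in>J. c r = c m \<longrightarrow> pos r \<noteq> y"
          "(P (c m) ! y, P (c l) ! (pos l + 1)) \<in> E" by (auto simp: bridged_def)
        have "P (c m) ! y \<notin> Z" using blocks[OF K'D(1)[OF lm(2)], of y] y(1,2) lm(6) by auto
        then have "P (c m) ! y \<in> A" using lm(7)[rule_format, of y] y(1) by auto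
        from step[OF this y(3)] show False
          using lm(3,5) Pin[OF K'D(1)[OF lm(1)] lm(4)] K'D(2)[OF lm(1) lm(4)] by auto
      qed
      show False
        using bridges[OF i(1) j(1)] nobridge[of i j] nobridge[of j i] i j d f \<open>d \<noteq> f\<close> by auto
    qed
    have last_A: "last (P d) = e" if "d \<in> K'" "last (P d) \<in> A" for d
      using linkageD(4)[OF P K'D(1)[OF that(1)]] that(2) AY by auto
    have last_inj: "last (P a) \<noteq> last (P b)"
      using linkage_inj_on_last[OF P] ab K'D(1) by (auto dest: inj_onD)
    have "\<exists>d\<in>K'. e \<in> A \<and> last (P d) \<notin> A"
    proof (cases "last (P a) \<in> A")
      case True
      then have "last (P a) = e" using last_A ab(1) by blast
      then show ?thesis using True last_inj last_A[OF ab(2)] ab(2) by auto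
    next
      case False
      then have "last (P b) \<in> A" using no_two[OF ab(1) False ab(2) _ ab(3)] by blast
      then show ?thesis using False last_A[OF ab(2)] ab(1) by auto
    qed
    then obtain d where d: "d \<in> K'" "e \<in> A" "last (P d) \<notin> A" by blast
    note dK = K'D[OF d(1)]
    obtain j0 where "j0 \<in> J" "c j0 = d" using first_block[OF d(1,3)] by auto
    define L where "L = length (P d)"
    have L: "3 * k + 3 \<le> L" using low[OF \<open>j0 \<in> J\<close>] \<open>c j0 = d\<close> by (simp add: L_def)
    define q where "q = L - (3 * k + 3)"
    have above_notZ: "P d ! t \<notin> Z" if t: "q < t" "t < L" for t
    proof
      assume "P d ! t \<in> Z"
      then obtain j where "j \<in> J" "c j = d" "pos j = t"
        using blocks[OF dK(1)] t(2) by (auto simp: L_def)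
      then show False using low[of j] t by (auto simp: q_def L_def)
    qed
    have above_notA: "P d ! t \<notin> A" if t: "q < t" "t < L" for t
    proof
      assume "P d ! t \<in> A"
      have "P d ! (t + n) \<in> A" if "t + n < L" for n
        using that
      proof (induction n)
        case (Suc n)
        then have len: "Suc (t + n) < length (P d)" by (simp add: L_def)
        have "P d ! Suc (t + n) \<notin> Z" using above_notZ[of "Suc (t + n)"] t(1) Suc.prems by simp
        then show ?case
          using step[OF _ Parc[OF dK(1) len]] Suc Pin[OF dK(1) len] dK(2)[OF len] by auto
      qed (use \<open>P d ! t \<in> A\<close> in simp)
      from this[of "L - 1 - t"] have "P d ! (L - 1) \<in> A" using t by simp
      then show False
        using d(3) linkageD(5)[OF P dK(1)] by (simp add: L_def last_conv_nth)
    qed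
    \<comment> \<open>The end itself belongs to \<open>Y\<close>, where the out-degree is not bounded by that of \<open>e\<close>.\<close>
    define v where "v = P d ! (L - 2)"
    have L2: "q < L - 2" "L - 2 < L" "Suc (L - 2) = L - 1" using L cardC by (auto simp: q_def)
    have v: "v \<in> V - X" "v \<notin> A" "v \<notin> Z" "v \<notin> C"
      using Pin[OF dK(1)] above_notA[OF L2(1,2)] above_notZ[OF L2(1,2)] dK(2) L2
      by (auto simp: v_def L_def)
    have "v \<notin> Y"
    proof
      assume "v \<in> Y"
      have "finite Y" using XY(3) by (intro finV) auto
      then have "finite (insert e Y)" "card K = card (insert e Y)"
        using e(1) XY(4) K(2) by auto
      then have "bij_betw (\<lambda>i. last (P i)) K (insert e Y)" by (rule linkage_bij_last[OF P])
      then obtain f where f: "f \<in> K" "last (P f) = v"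
        using \<open>v \<in> Y\<close> unfolding bij_betw_def by (metis imageE insertCI)
      have "last (P f) \<in> set (P f)" using linkageD(5)[OF P f(1)] by simp
      moreover have "v \<in> set (P d)" using L2 by (simp add: v_def L_def)
      ultimately have "f = d" using linkage_disjoint[OF P f(1) dK(1)] f(2) by simp
      then have "P d ! (L - 1) = P d ! (L - 2)"
        using f linkageD(5)[OF P dK(1)] by (simp add: v_def L_def last_conv_nth)
      moreover have "L - 1 < length (P d)" "L - 2 < length (P d)" "L - 1 \<noteq> L - 2"
        using L2 by (auto simp: L_def)
      ultimately show False using nth_eq_iff_index_eq[OF linkageD(2)[OF P dK(1)]] by blast
    qed
    then have "card (E `` {v}) \<le> card (E `` {e})" using e(2) v(1) by auto
    moreover have "card (E `` {e}) + 1 < card A + 3 * k"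
    proof -
      have "E `` {e} \<subseteq> (A - {e}) \<union> (C \<union> (Z \<union> X))"
        using step[OF d(2)] arcs_subset no_loop by blast
      then have "card (E `` {e}) \<le> card ((A - {e}) \<union> (C \<union> (Z \<union> X)))"
        using C(1) AU Z(1) XY(1) by (intro card_mono) (auto intro!: finV)
      also have "\<dots> \<le> card (A - {e}) + (card C + (card Z + card X))"
        by (meson add_le_mono card_Un_le le_refl le_trans)
      also have "card (A - {e}) = card A - 1" using d(2) by simp
      finally have "card (E `` {e}) \<le> card A - 1 + (card C + (card Z + card X))" .
      moreover have "0 < card A" using d(2) AU by (auto simp: card_gt_0_iff intro!: finV)
      ultimately show ?thesis using cardC Z(2) XY(2) by linarith
    qed
    moreover have "card A + 3 * k \<le> card (E `` {v}) + 1"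
    proof -
      define B where "B = (\<lambda>t. P d ! t) ` {q<..<L - 3}"
      have "inj_on (\<lambda>t. P d ! t) {q<..<L - 3}"
        using linkageD(2)[OF P dK(1)] by (auto simp: inj_on_def L_def nth_eq_iff_index_eq)
      then have "card B = L - 3 - Suc q" by (simp add: B_def card_image)
      then have cardB: "3 * k - 1 \<le> card B" using L by (simp add: q_def)
      have "A \<inter> B = {}" using above_notA by (auto simp: B_def)
      moreover have "A \<subseteq> E `` {v}"
      proof
        fix u assume u: "u \<in> A"
        have "(u, v) \<notin> E" using step[OF u, of v] v by auto
        moreover have "u \<in> V" "u \<noteq> v" using u AU v(2) by auto
        ultimately show "u \<in> E `` {v}" using comparable[of u v] v(1) by auto
      qed
      moreover have "B \<subseteq> E `` {v}"
      proof
        fix u assume "u \<in> B"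
        then obtain t where t: "u = P d ! t" "q < t" "t < L - 3" by (auto simp: B_def)
        have lens: "t < length (P d)" "L - 2 < length (P d)" using t L2 by (auto simp: L_def)
        have "(u, v) \<notin> Restr E (V - X)"
          using no_forward_chord[OF short K(1) dK(1), of t "L - 2"] t lens by (simp add: v_def)
        then have "(u, v) \<notin> E" using Pin[OF dK(1) lens(1)] t(1) v(1) by auto
        moreover have "u \<noteq> v"
          using nth_eq_iff_index_eq[OF linkageD(2)[OF P dK(1)] lens] t by (auto simp: v_def)
        ultimately show "u \<in> E `` {v}"
          using comparable[of u v] v(1) Pin[OF dK(1) lens(1)] t(1) by auto
      qed
      ultimately have "card (A \<union> B) \<le> card (E `` {v})"
        by (intro card_mono finV out_nbrs_subset) auto
      moreover have "card (A \<union> B) = card A + card B"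
        using \<open>A \<inter> B = {}\<close> AU by (intro card_Un_disjoint) (auto simp: B_def intro!: finV)
      ultimately have "card A + card B \<le> card (E `` {v})" by simp
      then show ?thesis using cardB cardC by linarith
    qed
    ultimately show False by linarith
  qed
qed

end

section \<open>Greedy choices\<close>

lemma ex_distinct_representatives:
  assumes "finite I" "\<And>i. i \<in> I \<Longrightarrow> card I \<le> card (S i)"
  shows "\<exists>f. inj_on f I \<and> (\<forall>i\<in>I. f i \<in> S i)"
  using assms
proof (induction I rule: finite_induct)
  case (insert i I)
  have "card I \<le> card (S j)" if "j \<in> I" for j using insert.prems[of j] insert.hyps that by simp
  then obtain f where f: "inj_on f I" "\<forall>j\<in>I. f j \<in> S j" using insert.IH by blast
  have "card (f ` I) < card (S i)"
    using card_image_le[OF insert.hyps(1), of f] insert.prems[of i] insert.hyps by simp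
  then have "\<not> S i \<subseteq> f ` I" using insert.hyps(1) card_mono[of "f ` I" "S i"] by auto
  then obtain v where v: "v \<in> S i" "v \<notin> f ` I" by blast
  have "inj_on (f(i := v)) (insert i I)" using f(1) v(2) insert.hyps(2)
    by (auto simp: inj_on_def)
  moreover have "\<forall>j\<in>insert i I. (f(i := v)) j \<in> S j" using f(2) v(1) insert.hyps(2) by auto
  ultimately show ?case by blast
qed auto

lemma ex_lowest_subset:
  fixes g :: "'a \<Rightarrow> nat"
  assumes "finite F" "n \<le> card F"
  shows "\<exists>W\<subseteq>F. card W = n \<and> (\<forall>w\<in>W. \<forall>u\<in>F - W. g w \<le> g u)"
  using assms(2)
proof (induction n)
  case (Suc n)
  then obtain W where W: "W \<subseteq> F" "card W = n" "\<forall>w\<in>W. \<forall>u\<in>F - W. g w \<le> g u" by auto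
  have "F - W \<noteq> {}" using W(1,2) Suc.prems by auto
  then obtain v where v: "v \<in> F - W" "\<forall>u\<in>F - W. g v \<le> g u"
    using ex_min_if_finite[of "g ` (F - W)"] \<open>finite F\<close> by (metis (no_types, lifting) arg_min_if_finite finite_Diff not_le)
  have "finite W" using W(1) \<open>finite F\<close> by (rule finite_subset)
  then show ?case
    using W v by (intro exI[of _ "insert v W"]) auto
qed auto

lemma ex_disjoint_choice:
  assumes "finite I"
    and ex: "\<And>i U. \<lbrakk>i \<in> I; finite U; card U \<le> m * card I\<rbrakk>
      \<Longrightarrow> \<exists>p. \<Phi> i p \<and> length p \<le> m \<and> set p \<inter> U = {}"
  shows "\<exists>h. (\<forall>i\<in>I. \<Phi> i (h i)) \<and> disjoint_family_on (\<lambda>i. set (h i)) I"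
proof -
  have "\<exists>h. (\<forall>i\<in>J. \<Phi> i (h i)) \<and> disjoint_family_on (\<lambda>i. set (h i)) J \<and>
      card (\<Union>i\<in>J. set (h i)) \<le> m * card J" if "J \<subseteq> I" for J
    using finite_subset[OF that \<open>finite I\<close>] that
  proof (induction J rule: finite_induct)
    case (insert i J)
    then obtain h where h: "\<forall>j\<in>J. \<Phi> j (h j)" "disjoint_family_on (\<lambda>i. set (h i)) J"
      "card (\<Union>j\<in>J. set (h j)) \<le> m * card J" by auto
    define U where "U = (\<Union>j\<in>J. set (h j))"
    have "card J \<le> card I" using insert.prems \<open>finite I\<close> by (auto intro: card_mono)
    then have "card U \<le> m * card I" using h(3) by (auto simp: U_def intro: order_trans)
    then obtain p where p: "\<Phi> i p" "length p \<le> m" "set p \<inter> U = {}"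
      using ex[of i U] insert.prems insert.hyps(1) by (auto simp: U_def)
    define h' where "h' = h(i := p)"
    have h': "h' i = p" "\<And>j. j \<in> J \<Longrightarrow> h' j = h j" using insert.hyps(2) by (auto simp: h'_def)
    have un: "(\<Union>j\<in>insert i J. set (h' j)) = set p \<union> U" using h' by (auto simp: U_def)
    have "card (set p \<union> U) \<le> m + m * card J"
      using card_Un_le[of "set p" U] card_length[of p] p(2) h(3) by (simp add: U_def)
    then have "card (\<Union>j\<in>insert i J. set (h' j)) \<le> m * card (insert i J)"
      using un insert.hyps by simp
    moreover have "disjoint_family_on (\<lambda>i. set (h' i)) (insert i J)"
      using h(2) p(3) h' insert.hyps(2)
      unfolding disjoint_family_on_insert[OF insert.hyps(2)]
      by (auto simp: U_def disjoint_family_on_def)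
    moreover have "\<forall>j\<in>insert i J. \<Phi> j (h' j)" using h(1) p(1) h' by auto
    ultimately show ?case by blast
  qed (auto simp: disjoint_family_on_def)
  then show ?thesis by blast
qed

text \<open>
  By induction along \<open>p\<close>: a walk that has avoided the linkage so far can enter it only at a position
  bounded by its own length, and \<open>p\<close> contains no vertex of such a position.
\<close>

lemma walk_stays_off_shortest_linkage:
  assumes short: "shortest_linkage E A B I Q" and "finite I"
    and "rel_walk E (r @ p)" "distinct (r @ p)" "r \<noteq> []" "hd r \<in> A"
    and "\<And>j. j \<in> I \<Longrightarrow> set r \<inter> set (Q j) = {}"
    and early: "\<And>j t. \<lbrakk>j \<in> I; t < length (Q j); t \<le> n\<rbrakk> \<Longrightarrow> Q j ! t \<notin> set p"
    and "length r + length p \<le> n + 1" and "j \<in> I"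
  shows "set p \<inter> set (Q j) = {}"
  using assms(3-9)
proof (induction p arbitrary: r)
  case (Cons v p)
  have r: "rel_walk E r" "(last r, v) \<in> E"
    using Cons.prems(1,3) rel_walk_append_iff[of r "v # p"] by auto
  have off: "v \<notin> set (Q j)" if j: "j \<in> I" for j
  proof
    assume "v \<in> set (Q j)"
    then obtain t where t: "t < length (Q j)" "Q j ! t = v" by (auto simp: in_set_conv_nth)
    have "t \<le> length r"
      using shortest_linkage_entry[OF short \<open>finite I\<close> j r(1) _ Cons.prems(4,5) t(1)] Cons.prems(2) r(2) t(2)
      by simp
    then show False using Cons.prems(6)[OF j t(1)] Cons.prems(7) t(2) by simp
  qed
  have "set p \<inter> set (Q j) = {}"
  proof (rule Cons.IH[of "r @ [v]"])
    show "set (r @ [v]) \<inter> set (Q j) = {}" if "j \<in> I" for j using Cons.prems(5)[OF that] off[OF that] by auto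
    show "Q j ! t \<notin> set p" if "j \<in> I" "t < length (Q j)" "t \<le> n" for j t
      using Cons.prems(6)[OF that] by simp
  qed (use Cons.prems in auto)
  then show ?case using off[OF \<open>j \<in> I\<close>] by simp
qed simp

section \<open>Second vertices that the linkage can avoid\<close>

context semicomplete_relation
begin

text \<open>A separator of at most \<open>k\<close> vertices and \<open>X\<close> together have at most \<open>2 * k\<close> vertices.\<close>

lemma ex_linkage_avoiding:
  assumes conn: "\<And>S a b. \<lbrakk>S \<subseteq> V; card S \<le> 2 * k; a \<in> V - S; b \<in> V - S; a \<noteq> b\<rbrakk>
      \<Longrightarrow> \<exists>p. rel_walk E p \<and> hd p = a \<and> last p = b \<and> set p \<inter> S = {}"
    and X: "X \<subseteq> V" "card X \<le> k"
    and A: "A \<subseteq> V - X" "k < card A" and B: "B \<subseteq> V - X" "k < card B"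
  shows "\<exists>P. linkage (Restr E (V - X)) A B {..<k + 1} P"
proof (rule menger)
  have finV: "finite U" if "U \<subseteq> V" for U using that finite_vertices by (rule finite_subset)
  show "finite (Restr E (V - X))" using finite_arcs by simp
  show finAB: "finite A" "finite B" using A(1) B(1) by (auto intro: finV)
  show "irrefl (Restr E (V - X))" using no_loop by (auto simp: irrefl_def)
  fix S assume S: "finite S" "separates (Restr E (V - X)) A B S"
  show "k + 1 \<le> card S"
  proof (rule ccontr)
    assume "\<not> ?thesis"
    then have cardS: "card S \<le> k" by simp
    have "\<not> A \<subseteq> S" "\<not> B \<subseteq> S"
      using card_mono[OF S(1), of A] card_mono[OF S(1), of B] A(2) B(2) cardS by auto
    then obtain a b where ab: "a \<in> A" "a \<notin> S" "b \<in> B" "b \<notin> S" by auto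
    show False
    proof (cases "a = b")
      case True
      then show False using separatesD[OF S(2), of "[a]"] ab by simp
    next
      case False
      define T where "T = X \<union> (S \<inter> V)"
      have "card T \<le> card X + card (S \<inter> V)" unfolding T_def by (rule card_Un_le)
      also have "card (S \<inter> V) \<le> card S" using S(1) by (simp add: card_mono)
      finally have "card T \<le> 2 * k" using X(2) cardS by simp
      moreover have "T \<subseteq> V" "a \<in> V - T" "b \<in> V - T" using X(1) A(1) B(1) ab by (auto simp: T_def)
      ultimately obtain p where p: "rel_walk E p" "hd p = a" "last p = b" "set p \<inter> T = {}"
        using conn[of T a b] False by auto
      have "set p \<subseteq> V" using p(1,2) ab(1) A(1) arcs_subset by (intro rel_walk_subset[of E]) auto
      then have sub: "set p \<subseteq> V - X" "set p \<inter> S = {}" using p(4) by (auto simp: T_def)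
      have "rel_walk (Restr E (V - X)) p" using p(1) sub(1) by (rule rel_walk_Restr)
      then show False using separatesD[OF S(2)] p(2,3) ab(1,3) sub(2) by blast
    qed
  qed
qed

text \<open>
  If at least \<open>k\<close> candidates of an index lie outside the columns, it gets one of them, which blocks
  nothing. Otherwise more than \<open>7 * k + 2\<close> of its candidates lie on one of the \<open>k + 1\<close> columns. The
  highest \<open>3 * k + 2\<close> positions of that column are ruled out, and more than \<open>4 * k\<close> candidates remain
  for the greedy choice of blocks.
\<close>

lemma ex_deletable_representatives:
  fixes F0 :: "'i set" and H :: "'i \<Rightarrow> 'a set"
  assumes conn: "\<And>S a b. \<lbrakk>S \<subseteq> V; card S \<le> 2 * k; a \<in> V - S; b \<in> V - S; a \<noteq> b\<rbrakk>
      \<Longrightarrow> \<exists>p. rel_walk E p \<and> hd p = a \<and> last p = b \<and> set p \<inter> S = {}"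
    and XY: "X \<subseteq> V" "card X \<le> k" "Y \<subseteq> V - X" "card Y = k"
    and W: "W \<subseteq> V - X" "k < card W"
    and e: "e \<in> V - X - Y" "\<And>v. v \<in> V - X - Y \<Longrightarrow> card (E `` {v}) \<le> card (E `` {e})"
    and F0: "finite F0" "card F0 \<le> k"
    and H: "\<And>i. i \<in> F0 \<Longrightarrow> H i \<subseteq> V - X - Y - W - {e}"
      "\<And>i. i \<in> F0 \<Longrightarrow> 7 * k\<^sup>2 + 29 * k \<le> card (H i)"
  shows "\<exists>z Q. inj_on z F0 \<and> (\<forall>i\<in>F0. z i \<in> H i) \<and>
      linkage (Restr E (V - X - z ` F0)) W Y {..<k} Q"
proof -
  have finV: "finite U" if "U \<subseteq> V" for U using that finite_vertices by (rule finite_subset)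
  let ?F = "Restr E (V - X)"
  define K where "K = {..<k + 1}"
  have K: "finite K" "card K = k + 1" by (auto simp: K_def)
  have "finite Y" using XY(3) by (intro finV) auto
  then have "k < card (insert e Y)" using e(1) XY(4) by auto
  then have "\<exists>P. linkage ?F W (insert e Y) {..<k + 1} P"
    using XY W e(1) conn by (intro ex_linkage_avoiding) auto
  then obtain P where short: "shortest_linkage ?F W (insert e Y) K P"
    unfolding K_def[symmetric] by (metis ex_shortest_linkage)
  have P: "linkage ?F W (insert e Y) K P" using short by (simp add: shortest_linkage_def)
  have PV: "set (P a) \<subseteq> V - X" if "a \<in> K" for a
    using linkageD[OF P that] W(1) by (intro rel_walk_subset[of ?F]) auto
  define cols where "cols = (\<Union>a\<in>K. set (P a))"
  define F where "F = {i\<in>F0. k \<le> card (H i - cols)}"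
  define J where "J = F0 - F"
  have FJ: "finite F" "finite J" "card F \<le> k" "card J \<le> k" "F0 = F \<union> J" "F \<inter> J = {}"
    using F0 card_mono[OF F0(1), of F] card_mono[OF F0(1), of J] by (auto simp: F_def J_def)
  have finH: "finite (H i)" if "i \<in> F0" for i using H(1)[OF that] by (intro finV) auto
  have "\<forall>i\<in>J. \<exists>a. a \<in> K \<and> 7 * k + 3 \<le> card (H i \<inter> set (P a))"
  proof (intro ballI, rule ccontr)
    fix i assume i: "i \<in> J" and no: "\<nexists>a. a \<in> K \<and> 7 * k + 3 \<le> card (H i \<inter> set (P a))"
    then have iF0: "i \<in> F0" and off: "card (H i - cols) < k" by (auto simp: J_def F_def)
    have "H i \<inter> cols = (\<Union>a\<in>K. H i \<inter> set (P a))" unfolding cols_def by blast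
    then have "card (H i \<inter> cols) \<le> (\<Sum>a\<in>K. card (H i \<inter> set (P a)))" 
      using card_UN_le[OF K(1), of "\<lambda>a. H i \<inter> set (P a)"] by (simp only:)
    also have "\<dots> \<le> (\<Sum>a\<in>K. 7 * k + 2)" 
    proof (rule sum_mono)
      fix a assume "a \<in> K"
      then have "\<not> 7 * k + 3 \<le> card (H i \<inter> set (P a))" using no by blast
      then show "card (H i \<inter> set (P a)) \<le> 7 * k + 2" by simp
    qed
    also have "\<dots> = 7 * k\<^sup>2 + 9 * k + 2" using K(2) by (simp add: algebra_simps power2_eq_square)
    finally have on: "card (H i \<inter> cols) \<le> 7 * k\<^sup>2 + 9 * k + 2" .
    have "card (H i) = card (H i \<inter> cols) + card (H i - cols)"
      using finH[OF iF0] by (simp add: card_Int_Diff)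
    then show False using H(2)[OF iF0] on off by linarith
  qed
  from bchoice[OF this] obtain c where c: "\<And>i. i \<in> J \<Longrightarrow> c i \<in> K"
      "\<And>i. i \<in> J \<Longrightarrow> 7 * k + 3 \<le> card (H i \<inter> set (P (c i)))" by blast
  define R where "R i = {t. t + (3 * k + 3) \<le> length (P (c i)) \<and> P (c i) ! t \<in> H i}" for i
  have R_sub: "R i \<subseteq> {0..<length (P (c i))}" for i by (auto simp: R_def)
  have cardR: "4 * card J < card (R i)" if i: "i \<in> J" for i
  proof -
    define L where "L = length (P (c i))"
    have finR: "finite (R i)" using R_sub by (rule finite_subset) simp
    have "H i \<inter> set (P (c i)) \<subseteq> (\<lambda>t. P (c i) ! t) ` (R i \<union> {L - (3 * k + 2)..<L})"
    proof
      fix v assume v: "v \<in> H i \<inter> set (P (c i))"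
      then obtain t where t: "t < L" "P (c i) ! t = v" by (auto simp: in_set_conv_nth L_def)
      then have "t \<in> R i \<union> {L - (3 * k + 2)..<L}" using v by (auto simp: R_def L_def)
      then show "v \<in> (\<lambda>t. P (c i) ! t) ` (R i \<union> {L - (3 * k + 2)..<L})" using t(2) by blast
    qed
    then have "card (H i \<inter> set (P (c i))) \<le> card (R i \<union> {L - (3 * k + 2)..<L})"
      using finR by (intro surj_card_le) auto
    also have "\<dots> \<le> card (R i) + (3 * k + 2)"
      using card_Un_le[of "R i" "{L - (3 * k + 2)..<L}"] by simp
    finally show ?thesis using c(2)[OF i] FJ(4) by simp
  qed
  have semi: "(u, v) \<in> ?F \<or> (v, u) \<in> ?F"
    if "a \<in> K" "b \<in> K" "u \<in> set (P a)" "v \<in> set (P b)" "u \<noteq> v" for a b u v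
    using that PV[of a] PV[of b] comparable[of u v] by auto
  have "c ` J \<subseteq> K" using c(1) by auto
  then have "\<exists>pos. (\<forall>j\<in>J. pos j \<in> R j) \<and>
      (\<forall>i\<in>J. \<forall>j\<in>J. i \<noteq> j \<longrightarrow> c i = c j \<longrightarrow> pos i \<noteq> pos j) \<and>
      (\<forall>i\<in>J. \<forall>j\<in>J. c i \<noteq> c j \<longrightarrow>
         bridged ?F P c pos J 0 i j \<or> bridged ?F P c pos J 0 j i)"
    using choose_bridged_positions[where lo = "\<lambda>_. 0", OF short K(1) semi FJ(2) _ R_sub cardR]
    by simp
  then obtain pos where pos: "\<And>j. j \<in> J \<Longrightarrow> pos j \<in> R j"
    and pos_neq: "\<And>i j. \<lbrakk>i \<in> J; j \<in> J; i \<noteq> j; c i = c j\<rbrakk> \<Longrightarrow> pos i \<noteq> pos j"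
    and bridges: "\<And>i j. \<lbrakk>i \<in> J; j \<in> J; c i \<noteq> c j\<rbrakk> \<Longrightarrow>
        bridged ?F P c pos J 0 i j \<or> bridged ?F P c pos J 0 j i" by blast
  obtain f where f: "inj_on f F" "\<And>i. i \<in> F \<Longrightarrow> f i \<in> H i - cols"
    using ex_distinct_representatives[of F "\<lambda>i. H i - cols"] FJ(1,3)
    by (force simp: F_def)
  define z where "z i = (if i \<in> J then P (c i) ! pos i else f i)" for i
  have zF: "z i = f i" if "i \<in> F" for i using that FJ(6) by (auto simp: z_def)
  have zJ: "z i = P (c i) ! pos i" "pos i < length (P (c i))" "z i \<in> set (P (c i))"
    "pos i + (3 * k + 3) \<le> length (P (c i))" if "i \<in> J" for i
    using pos[OF that] that by (auto simp: z_def R_def)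
  have zH: "z i \<in> H i" if "i \<in> F0" for i
    using that FJ(5) zF f(2) pos by (auto simp: z_def R_def)
  have on_column: "c i = a \<and> pos i = t"
    if "i \<in> J" "a \<in> K" "t < length (P a)" "z i = P a ! t" for i a t
  proof -
    have "c i = a"
      using linkage_disjoint[OF P c(1)[OF that(1)] that(2) zJ(3)[OF that(1)]] that(3,4) by simp
    then show ?thesis
      using that zJ(1,2)[OF that(1)] linkageD(2)[OF P that(2)] by (auto simp: nth_eq_iff_index_eq)
  qed
  have off_column: "z i \<notin> cols" if "i \<in> F" for i using f(2)[OF that] zF[OF that] by simp
  have in_cols: "z i \<in> cols" if "i \<in> J" for i using zJ(3)[OF that] c(1)[OF that] by (auto simp: cols_def)
  have "inj_on z F0"
  proof (rule inj_onI)
    fix i j assume ij: "i \<in> F0" "j \<in> F0" "z i = z j"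
    consider "i \<in> F" "j \<in> F" | "i \<in> J" "j \<in> J" | "i \<in> F" "j \<in> J" | "i \<in> J" "j \<in> F"
      using ij FJ(5) by blast
    then show "i = j"
    proof cases
      case 1 then show ?thesis using f(1) ij(3) zF by (auto dest: inj_onD)
    next
      case 2
      then have "c i = c j \<and> pos i = pos j"
        using on_column[of i "c j" "pos j"] c(1) zJ ij(3) by simp
      then show ?thesis using pos_neq 2 by blast
    next
      case 3 then show ?thesis using off_column in_cols ij(3) by metis
    next
      case 4 then show ?thesis using off_column in_cols ij(3) by metis
    qed
  qed
  moreover have "\<exists>Q. linkage (Restr E (V - X - z ` F0)) W Y {..<k} Q"
  proof (rule linkage_avoiding_blocks[OF short K XY W(1) e, where J = J and c = c and pos = pos])
    show "z ` F0 \<subseteq> V - X" "z ` F0 \<inter> W = {}" "z ` F0 \<inter> insert e Y = {}"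
      using zH H(1) by blast+
    show "card (z ` F0) \<le> k" using card_image_le[OF F0(1), of z] F0(2) by simp
    show "pos j + (3 * k + 3) \<le> length (P (c j))" if "j \<in> J" for j using zJ(4)[OF that] .
    show "\<exists>j\<in>J. c j = a \<and> pos j = t" if at: "a \<in> K" "t < length (P a)" "P a ! t \<in> z ` F0" for a t
    proof -
      obtain i where i: "i \<in> F0" "z i = P a ! t" using at(3) by auto
      have "z i \<in> cols" using i(2) at(1) nth_mem[OF at(2)] unfolding cols_def by auto
      then have "i \<in> J" using off_column i(1) FJ(5) by auto
      then show ?thesis using on_column[OF _ at(1,2) i(2)] by blast
    qed
  qed (use bridges in auto)
  ultimately show ?thesis using zH by blast
qed

section \<open>Joining the sources to the linkage\<close>

text \<open>
  Call a vertex low if more than \<open>k\<close> hub vertices dominate it; at least one of them is then not used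
  by any given linkage of \<open>k\<close> paths that starts in \<open>W\<close>. The indices in \<open>G\<close> have many low
  out-neighbours. Their second vertices are chosen after the linkage \<open>Q\<close>: the only low vertices on
  \<open>Q\<close> outside \<open>W\<close> are second vertices of its paths, and from another low vertex the walk to the hub stays away
  from \<open>Q\<close>. The indices in \<open>F\<close> have many out-neighbours that are not low. Their second vertices \<open>Zh\<close>
  are chosen before \<open>Q\<close>, which avoids them, and each of them has an arc to a hub vertex \<open>w' i\<close> that
  \<open>Q\<close> does not use.
\<close>

theorem linked_if_highly_connected:
  fixes x y :: "'i \<Rightarrow> 'a"
  assumes "1 \<le> k"
    and conn: "\<And>S a b. \<lbrakk>S \<subseteq> V; card S \<le> 2 * k; a \<in> V - S; b \<in> V - S; a \<noteq> b\<rbrakk>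
      \<Longrightarrow> \<exists>p. rel_walk E p \<and> hd p = a \<and> last p = b \<and> set p \<inter> S = {}"
    and deg: "\<And>v. v \<in> V \<Longrightarrow> 7 * k\<^sup>2 + 36 * k \<le> card (E `` {v})"
    and I: "finite I" "card I = k"
    and x: "inj_on x I" "x ` I \<subseteq> V" and y: "inj_on y I" "y ` I \<subseteq> V"
    and xy: "x ` I \<inter> y ` I = {}"
  shows "\<exists>R. (\<forall>i\<in>I. rel_walk E (R i) \<and> distinct (R i) \<and> hd (R i) = x i \<and> last (R i) = y i) \<and>
    disjoint_family_on (\<lambda>i. set (R i)) I"
proof -
  have finV: "finite U" if "U \<subseteq> V" for U using that finite_vertices by (rule finite_subset)
  define X where "X = x ` I"
  define Y where "Y = y ` I"
  have XY: "X \<subseteq> V" "card X = k" "Y \<subseteq> V - X" "card Y = k" "finite X" "finite Y"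
    using x y xy I by (auto simp: X_def Y_def card_image)
  have k2: "k \<le> k\<^sup>2" using \<open>1 \<le> k\<close> by (simp add: power2_eq_square)
  have "V \<noteq> {}" using x(2) I \<open>1 \<le> k\<close> by fastforce
  then obtain v0 where "v0 \<in> V" by auto
  then have "7 * k\<^sup>2 + 36 * k \<le> card V"
    using deg[of v0] card_mono[OF finite_vertices out_nbrs_subset[of v0]] by linarith
  moreover have "card (V - X - Y) = card V - k - k"
    using XY by (simp add: card_Diff_subset)
  ultimately have cardF: "3 * k \<le> card (V - X - Y)" by linarith
  obtain W where W: "W \<subseteq> V - X - Y" "card W = 3 * k"
    and hub: "\<And>w u. \<lbrakk>w \<in> W; u \<in> V - X - Y - W\<rbrakk> \<Longrightarrow> card (non_in_nbrs w) \<le> card (non_in_nbrs u)"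
    using ex_lowest_subset[OF _ cardF, of "\<lambda>v. card (non_in_nbrs v)"] finite_vertices by auto
  have finW: "finite W" using W(1) by (intro finV) auto
  have "0 < card (V - X - Y)" using cardF \<open>1 \<le> k\<close> by simp
  then have ne: "(\<lambda>v. card (E `` {v})) ` (V - X - Y) \<noteq> {}" by (auto simp only: card_gt_0_iff)
  have "Max ((\<lambda>v. card (E `` {v})) ` (V - X - Y)) \<in> (\<lambda>v. card (E `` {v})) ` (V - X - Y)"
    using ne finite_vertices by (intro Max_in) auto
  then obtain e where e: "e \<in> V - X - Y"
    "card (E `` {e}) = Max ((\<lambda>v. card (E `` {v})) ` (V - X - Y))" by auto
  have emax: "card (E `` {v}) \<le> card (E `` {e})" if "v \<in> V - X - Y" for v
    unfolding e(2) using that finite_vertices by (intro Max_ge) auto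
  define N where "N i = E `` {x i} - (X \<union> Y \<union> W \<union> {e})" for i
  define low where "low v \<longleftrightarrow> k < card {w \<in> W. (w, v) \<in> E}" for v
  define G where "G = {i \<in> I. 2 * k \<le> card {v \<in> N i. low v}}"
  define F where "F = I - G"
  define H where "H i = {v \<in> N i. \<not> low v}" for i
  have N_sub: "N i \<subseteq> V - X - Y - W - {e}" for i using out_nbrs_subset[of "x i"] by (auto simp: N_def)
  have finN: "finite (N i)" for i using N_sub[of i] by (intro finV) auto
  have GF: "finite G" "finite F" "I = G \<union> F" "G \<inter> F = {}" "card G + card F = k"
  proof -
    show "finite G" "finite F" "I = G \<union> F" "G \<inter> F = {}" using I(1) by (auto simp: G_def F_def)
    then show "card G + card F = k" using card_Un_disjoint[of G F] I(2) by simp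
  qed
  have H_sub: "H i \<subseteq> V - X - Y - W - {e}" for i using N_sub[of i] by (auto simp only: H_def)
  have cardH: "7 * k\<^sup>2 + 29 * k \<le> card (H i)" if i: "i \<in> F" for i
  proof -
    have "x i \<in> V" using x(2) i by (auto simp: F_def)
    then have "7 * k\<^sup>2 + 36 * k \<le> card (E `` {x i})" by (rule deg)
    moreover have "card (E `` {x i}) - card (X \<union> Y \<union> W \<union> {e}) \<le> card (N i)"
      unfolding N_def using XY finW by (intro diff_card_le_card_Diff) auto
    moreover have "card (X \<union> Y \<union> W \<union> {e}) \<le> card X + card Y + card W + card {e}"
      by (meson add_le_mono1 card_Un_le le_trans)
    moreover have "card (N i) = card {v \<in> N i. low v} + card (H i)"
    proof -
      have "N i = {v \<in> N i. low v} \<union> H i" by (auto simp: H_def)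
      then show ?thesis
        using finN[of i] by (subst card_Un_disjoint[symmetric]) (auto simp: H_def)
    qed
    moreover have "card {v \<in> N i. low v} < 2 * k" using i by (auto simp: F_def G_def)
    ultimately show ?thesis using XY(2,4) W(2) by simp
  qed
  have "\<exists>z Q. inj_on z F \<and> (\<forall>i\<in>F. z i \<in> H i) \<and>
      linkage (Restr E (V - X - z ` F)) W Y {..<k} Q"
  proof (rule ex_deletable_representatives[OF conn])
    show "W \<subseteq> V - X" "k < card W" "card F \<le> k" using W GF(5) \<open>1 \<le> k\<close> by auto
  qed (use XY e(1) emax GF(2) H_sub cardH in simp_all)
  then obtain zh Q0 where zh: "inj_on zh F" "\<And>i. i \<in> F \<Longrightarrow> zh i \<in> H i"
    and Q0: "linkage (Restr E (V - X - zh ` F)) W Y {..<k} Q0" by blast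
  define Zh where "Zh = zh ` F"
  let ?E = "Restr E (V - X - Zh)"
  have cardZh: "card Zh \<le> card F" unfolding Zh_def using GF(2) by (rule card_image_le)
  have Zh_sub: "Zh \<subseteq> V - X - Y - W" using zh(2) N_sub by (fastforce simp: Zh_def H_def)
  \<comment> \<open>Where the paths start does not matter, so the linkage can be indexed by its ends.\<close>
  obtain Q where Q_short: "shortest_linkage ?E W Y I Q" and lastQ: "\<And>i. i \<in> I \<Longrightarrow> last (Q i) = y i"
  proof -
    obtain g where g: "bij_betw g I {..<k}"
      using I by (metis atLeast0LessThan ex_bij_betw_finite_nat)
    then have "linkage ?E W Y I (Q0 \<circ> g)"
      using Q0 by (intro linkage_reindex[of ?E W Y "{..<k}"]) (auto simp: bij_betw_def Zh_def)
    then obtain Q1 where Q1: "shortest_linkage ?E W Y I Q1" by (rule ex_shortest_linkage)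
    then have last_bij: "bij_betw (\<lambda>i. last (Q1 i)) I Y"
      using XY(4,6) I(2) by (intro linkage_bij_last) (auto simp: shortest_linkage_def)
    then have bij: "bij_betw (the_inv_into I (\<lambda>i. last (Q1 i))) Y I"
      and inv: "\<And>b. b \<in> Y \<Longrightarrow> last (Q1 (the_inv_into I (\<lambda>i. last (Q1 i)) b)) = b"
      using bij_betw_the_inv_into[OF last_bij] f_the_inv_into_f[of "\<lambda>i. last (Q1 i)" I]
      by (simp_all add: bij_betw_def)
    have "bij_betw y I Y" using y(1) by (simp add: Y_def bij_betw_def)
    then have "bij_betw (the_inv_into I (\<lambda>i. last (Q1 i)) \<circ> y) I I" using bij by (rule bij_betw_trans)
    from shortest_linkage_reindex[OF Q1 this] show thesis
      by (rule that) (simp add: inv Y_def)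
  qed
  have Q: "linkage ?E W Y I Q" using Q_short by (simp add: shortest_linkage_def)
  have QV: "set (Q i) \<subseteq> V - X - Zh" if "i \<in> I" for i
    using linkageD[OF Q that] W(1) Zh_sub by (intro rel_walk_subset[of ?E]) auto
  have QE: "rel_walk E (Q i)" if "i \<in> I" for i
    using rel_walk_mono[OF linkageD(1)[OF Q that]] by auto
  define s where "s i = hd (Q i)" for i
  have sW: "s i \<in> W" if "i \<in> I" for i using linkageD(3)[OF Q that] by (simp add: s_def)
  have card_s: "card (s ` I) \<le> k" "finite (s ` I)" using card_image_le[OF I(1), of s] I by auto
  have Q0s: "Q i ! 0 = s i" if "i \<in> I" for i using linkageD(5)[OF Q that] by (simp add: s_def hd_conv_nth)
  have free: "w \<notin> set (Q i)" if "w \<in> W" "w \<notin> s ` I" "i \<in> I" for w i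
  proof
    assume "w \<in> set (Q i)"
    then obtain t where t: "t < length (Q i)" "Q i ! t = w" by (auto simp: in_set_conv_nth)
    then have "t = 0" using shortest_linkage_source_first[OF Q_short I(1) that(3)] that(1) by simp
    then show False using t Q0s[OF that(3)] that(2,3) by auto
  qed
  have low_dominated: "\<exists>w\<in>W. w \<notin> s ` I \<and> (w, v) \<in> E" if "low v" for v
  proof -
    have "\<not> {w \<in> W. (w, v) \<in> E} \<subseteq> s ` I"
      using card_mono[OF card_s(2), of "{w \<in> W. (w, v) \<in> E}"] card_s(1) that by (auto simp: low_def)
    then show ?thesis by blast
  qed
  define S1 where "S1 = (\<lambda>j. Q j ! 1) ` I"
  have S1: "card S1 \<le> k" "finite S1" using card_image_le[OF I(1), of "\<lambda>j. Q j ! 1"] I by (auto simp: S1_def)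
  have low_off: "v \<notin> set (Q j)"
    if v: "low v" "v \<in> V - X - Zh" "v \<notin> W" "v \<notin> S1" and j: "j \<in> I" for v j
  proof
    assume "v \<in> set (Q j)"
    then obtain t where t: "t < length (Q j)" "Q j ! t = v" by (auto simp: in_set_conv_nth)
    obtain w where w: "w \<in> W" "w \<notin> s ` I" "(w, v) \<in> E" using low_dominated[OF v(1)] by auto
    have "(last [w], Q j ! t) \<in> ?E" using w W(1) Zh_sub v(2) t(2) by auto
    then have "t \<le> length [w]"
      using w free by (intro shortest_linkage_entry[OF Q_short I(1) j, of "[w]"] t) auto
    then have "t = 0 \<or> t = 1" by auto
    then show False using t(2) Q0s[OF j] sW[OF j] v(3,4) j by (auto simp: S1_def)
  qed
  obtain zl where zl: "inj_on zl G" "\<And>i. i \<in> G \<Longrightarrow> zl i \<in> {v \<in> N i. low v} - (Zh \<union> S1)"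
  proof -
    have "card G \<le> card ({v \<in> N i. low v} - (Zh \<union> S1))" if "i \<in> G" for i
    proof -
      have "card {v \<in> N i. low v} - card (Zh \<union> S1) \<le> card ({v \<in> N i. low v} - (Zh \<union> S1))"
        using S1(2) GF(2) by (intro diff_card_le_card_Diff) (auto simp: Zh_def)
      moreover have "card (Zh \<union> S1) \<le> card F + k"
        using card_Un_le[of Zh S1] S1(1) cardZh by linarith
      moreover have "2 * k \<le> card {v \<in> N i. low v}" using that by (simp add: G_def)
      ultimately show ?thesis using GF(5) by linarith
    qed
    then show thesis
      using ex_distinct_representatives[OF GF(1), of "\<lambda>i. {v \<in> N i. low v} - (Zh \<union> S1)"] that by blast
  qed
  define z where "z i = (if i \<in> G then zl i else zh i)" for i
  have zN: "z i \<in> N i" if "i \<in> I" for i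
    using that zl(2)[of i] zh(2)[of i] by (auto simp: z_def F_def H_def)
  have z_sub: "z i \<in> V - X - Y - W" if "i \<in> I" for i using zN[OF that] N_sub by blast
  have zG: "z i \<notin> Zh" if "i \<in> G" for i using zl(2)[OF that] that by (simp add: z_def)
  have zF: "z i \<in> Zh" if "i \<in> I" "i \<notin> G" for i using that unfolding z_def Zh_def F_def by simp
  have z_inj: "inj_on z I"
  proof (rule inj_onI)
    fix i j assume ij: "i \<in> I" "j \<in> I" "z i = z j"
    show "i = j"
    proof (cases "i \<in> G \<longleftrightarrow> j \<in> G")
      case True
      then show ?thesis using ij zl(1) zh(1) by (auto simp: z_def F_def dest: inj_onD split: if_splits)
    next
      case False
      then show ?thesis using zG zF ij by metis
    qed
  qed
  define Z where "Z = z ` I"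
  have cardZ: "card Z \<le> k" "finite Z" using card_image_le[OF I(1), of z] I by (auto simp: Z_def)
  have ZhZ: "Zh \<subseteq> Z"
  proof
    fix v assume "v \<in> Zh"
    then obtain i where "i \<in> F" "v = zh i" by (auto simp: Zh_def)
    then have "i \<in> I" "v = z i" by (auto simp: z_def F_def)
    then show "v \<in> Z" by (auto simp: Z_def)
  qed
  have zQ: "z i \<notin> set (Q j)" if i: "i \<in> I" and j: "j \<in> I" for i j
  proof (cases "i \<in> G")
    case True
    have "low (z i)" "z i \<notin> Zh" "z i \<notin> S1" using zG[OF True] zl(2)[OF True] True by (auto simp: z_def)
    moreover have "z i \<in> V - X - Zh" "z i \<notin> W" using z_sub[OF i] calculation(2) by auto
    ultimately show ?thesis using low_off j by blast
  next
    case False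
    then have "z i \<in> Zh" using zF i by simp
    then show ?thesis using QV[OF j] by auto
  qed
  obtain w' where w': "inj_on w' F" "\<And>i. i \<in> F \<Longrightarrow> w' i \<in> {w \<in> W. (z i, w) \<in> E} - s ` I"
  proof -
    have "card F \<le> card ({w \<in> W. (z i, w) \<in> E} - s ` I)" if i: "i \<in> F" for i
    proof -
      have zi: "z i \<in> V" "z i \<notin> W" "\<not> low (z i)"
        using i zh(2)[OF i] N_sub[of i] by (auto simp: z_def F_def H_def)
      have "W \<subseteq> {w \<in> W. (w, z i) \<in> E} \<union> {w \<in> W. (z i, w) \<in> E}"
        using zi(1,2) W(1) comparable by blast
      then have "card W \<le> card ({w \<in> W. (w, z i) \<in> E} \<union> {w \<in> W. (z i, w) \<in> E})"
        using finW by (intro card_mono) auto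
      also have "\<dots> \<le> card {w \<in> W. (w, z i) \<in> E} + card {w \<in> W. (z i, w) \<in> E}" by (rule card_Un_le)
      finally have "2 * k \<le> card {w \<in> W. (z i, w) \<in> E}" using W(2) zi(3) by (simp add: low_def)
      moreover have "card {w \<in> W. (z i, w) \<in> E} - card (s ` I) \<le> card ({w \<in> W. (z i, w) \<in> E} - s ` I)"
        using card_s(2) by (rule diff_card_le_card_Diff)
      ultimately show ?thesis using card_s(1) GF(5) by linarith
    qed
    then show thesis
      using ex_distinct_representatives[OF GF(2), of "\<lambda>i. {w \<in> W. (z i, w) \<in> E} - s ` I"] that by blast
  qed
  \<comment> \<open>The path of index \<open>i\<close> is \<open>x i\<close>, then \<open>pre i\<close>, then \<open>v i\<close>, then a short connection to the
    start \<open>s i\<close> of \<open>Q i\<close>, then \<open>Q i\<close>.\<close>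
  define pre where "pre i = (if i \<in> G then [] else [z i])" for i
  define v where "v i = (if i \<in> G then z i else w' i)" for i
  have w'D: "w' i \<in> W" "w' i \<notin> s ` I" "(z i, w' i) \<in> E" if "i \<in> I" "i \<notin> G" for i
    using w'(2)[of i] that by (auto simp: F_def)
  \<comment> \<open>The walk that leads to \<open>v i\<close> from an unused hub vertex has at most two vertices and a
    connection has at most two more, so a first contact with \<open>Q\<close> would be at position 3 or lower.\<close>
  define S0 where "S0 = X \<union> Y \<union> Z \<union> W \<union> (\<Union>t\<in>{1,2,3}. (\<lambda>j. Q j ! t) ` I)"
  have finS0: "finite S0" using XY cardZ(2) finW I(1) by (auto simp: S0_def)
  have cardS0: "card S0 \<le> 9 * k"
  proof -
    have "card (\<Union>t\<in>{1,2,3::nat}. (\<lambda>j. Q j ! t) ` I) \<le> (\<Sum>t\<in>{1,2,3::nat}. card ((\<lambda>j. Q j ! t) ` I))"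
      by (rule card_UN_le) simp
    also have "\<dots> \<le> (\<Sum>t\<in>{1,2,3::nat}. k)" using card_image_le[OF I(1)] I(2) by (intro sum_mono) auto
    also have "\<dots> = 3 * k" by simp
    finally have "card (\<Union>t\<in>{1,2,3::nat}. (\<lambda>j. Q j ! t) ` I) \<le> 3 * k" .
    moreover have "card S0 \<le> card X + card Y + card Z + card W + card (\<Union>t\<in>{1,2,3::nat}. (\<lambda>j. Q j ! t) ` I)"
      unfolding S0_def by (meson add_le_mono1 card_Un_le le_trans)
    ultimately show ?thesis using XY(2,4) cardZ(1) W(2) by linarith
  qed
  define \<Phi> where "\<Phi> i p \<longleftrightarrow> distinct p \<and> set p \<inter> S0 = {} \<and> rel_walk E (v i # p @ [s i])" for i p
  have vV: "v i \<in> V" if "i \<in> I" for i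
    using z_sub[OF that] w'D[OF that] W(1) by (auto simp: v_def)
  have v_neq: "v i \<noteq> s i" if "i \<in> I" for i
    using z_sub[OF that] w'D[OF that] sW[OF that] that by (auto simp: v_def)
  have "\<exists>p. \<Phi> i p \<and> length p \<le> 2 \<and> set p \<inter> U = {}"
    if i: "i \<in> I" and U: "finite U" "card U \<le> 2 * card I" for i U
  proof -
    define S where "S = S0 \<union> U"
    have "card S \<le> 11 * k" using card_Un_le[of S0 U] cardS0 U(2) I(2) by (simp add: S_def)
    then have "3 * card S \<le> card (E `` {v i})" using deg[OF vV[OF i]] k2 by linarith
    moreover have "s i \<in> V" "s i \<in> S" using sW[OF i] W(1) by (auto simp: S_def S0_def)
    moreover have "card (non_in_nbrs (s i)) \<le> card (non_in_nbrs u)" if "u \<in> V - S" for u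
      using that by (intro hub sW i) (auto simp: S_def S0_def)
    moreover have "finite S" using finS0 U(1) by (simp add: S_def)
    ultimately obtain p where "length p \<le> 2" "distinct p" "set p \<inter> S = {}" "rel_walk E (v i # p @ [s i])"
      using short_walk_to_hub[OF v_neq[OF i]] by blast
    then show ?thesis by (auto simp: \<Phi>_def S_def)
  qed
  then have "\<exists>h. (\<forall>i\<in>I. \<Phi> i (h i) \<and> length (h i) \<le> 2) \<and> disjoint_family_on (\<lambda>i. set (h i)) I"
    by (intro ex_disjoint_choice[OF I(1), of 2]) auto
  then obtain h where h: "\<And>i. i \<in> I \<Longrightarrow> \<Phi> i (h i)" "\<And>i. i \<in> I \<Longrightarrow> length (h i) \<le> 2"
    and h_disj: "disjoint_family_on (\<lambda>i. set (h i)) I" by blast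
  have hS0: "set (h i) \<inter> S0 = {}" and h_dist: "distinct (h i)"
    and h_walk: "rel_walk E (v i # h i @ [s i])" if "i \<in> I" for i
    using h(1)[OF that] by (auto simp: \<Phi>_def)
  have hV: "set (h i) \<subseteq> V" if "i \<in> I" for i
    using rel_walk_subset[OF h_walk[OF that] _ arcs_subset] vV[OF that] by auto
  have hQ: "set (h i) \<inter> set (Q j) = {}" if i: "i \<in> I" and j: "j \<in> I" for i j
  proof -
    have walk_vh: "rel_walk E (v i # h i)"
      using h_walk[OF i] rel_walk_append_iff[of "v i # h i" "[s i]"] by simp
    have "\<exists>r. rel_walk E (r @ h i) \<and> distinct (r @ h i) \<and> r \<noteq> [] \<and> hd r \<in> W \<and>
        set r \<subseteq> V - X - Zh \<and> (\<forall>j\<in>I. set r \<inter> set (Q j) = {}) \<and> length r \<le> 2"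
    proof (cases "i \<in> G")
      case True
      then have z: "v i = z i" "low (z i)" "z i \<notin> Zh" using zl(2)[OF True] by (auto simp: v_def z_def)
      obtain w where w: "w \<in> W" "w \<notin> s ` I" "(w, z i) \<in> E" using low_dominated[OF z(2)] by auto
      have "rel_walk E ([w] @ (v i # h i))"
        using walk_vh w(3) z(1) rel_walk_append_iff[of "[w]" "v i # h i" E] by simp
      then show ?thesis
        using w z free zQ[OF i] z_sub[OF i] W(1) Zh_sub hS0[OF i] h_dist[OF i] i
        by (intro exI[of _ "[w, z i]"]) (auto simp: S0_def Z_def)
    next
      case False
      note w = w'D[OF i False]
      show ?thesis
        using walk_vh w free W(1) Zh_sub hS0[OF i] h_dist[OF i] False
        by (intro exI[of _ "[w' i]"]) (auto simp: S0_def v_def)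
    qed
    then obtain r where r: "rel_walk E (r @ h i)" "distinct (r @ h i)" "r \<noteq> []" "hd r \<in> W"
      "set r \<subseteq> V - X - Zh" "\<forall>j\<in>I. set r \<inter> set (Q j) = {}" "length r \<le> 2" by auto
    have "set (h i) \<subseteq> V - X - Zh" using hV[OF i] hS0[OF i] ZhZ by (auto simp: S0_def)
    then have walk: "rel_walk ?E (r @ h i)" using r(1,5) by (intro rel_walk_Restr) auto
    have early: "Q j ! t \<notin> set (h i)" if t: "j \<in> I" "t < length (Q j)" "t \<le> 3" for j t
    proof -
      have "t = 0 \<or> t \<in> {1, 2, 3}" using t(3) by auto
      then have "Q j ! t \<in> S0"
      proof
        assume "t = 0"
        then show ?thesis using Q0s[OF t(1)] sW[OF t(1)] by (simp add: S0_def)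
      next
        assume "t \<in> {1, 2, 3}"
        then show ?thesis using t(1) unfolding S0_def by blast
      qed
      then show ?thesis using hS0[OF i] by auto
    qed
    have "length r + length (h i) \<le> 3 + 1" using r(7) h(2)[OF i] by simp
    from walk_stays_off_shortest_linkage[OF Q_short I(1) walk r(2-4) r(6)[rule_format] early this j]
    show ?thesis .
  qed
  define R where "R i = x i # pre i @ [v i] @ h i @ Q i" for i
  define M where "M i = set (pre i @ [v i])" for i
  have setR: "set (R i) = {x i} \<union> M i \<union> set (h i) \<union> set (Q i)" for i by (auto simp: R_def M_def)
  have M_def': "M i = (if i \<in> G then {z i} else {z i, w' i})" for i by (auto simp: M_def pre_def v_def)
  have M_sub: "M i \<subseteq> Z \<union> (W - s ` I)" if "i \<in> I" for i
    using w'D[OF that] that by (auto simp: M_def' Z_def)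
  have MX: "X \<inter> M i = {}" if "i \<in> I" for i
    using M_sub[OF that] z_sub W(1) by (fastforce simp: Z_def)
  have Mh: "M i \<inter> set (h j) = {}" if "i \<in> I" "j \<in> I" for i j
    using M_sub[OF that(1)] hS0[OF that(2)] by (auto simp: S0_def)
  have MQ: "M i \<inter> set (Q j) = {}" if "i \<in> I" "j \<in> I" for i j
    using zQ[OF that] w'D[OF that(1)] free that by (auto simp: M_def')
  have MM: "M i \<inter> M j = {}" if ij: "i \<in> I" "j \<in> I" "i \<noteq> j" for i j
  proof -
    have "z i \<noteq> z j" using z_inj ij by (auto dest: inj_onD)
    moreover have "z i \<noteq> w' j" if "j \<notin> G" using z_sub[OF ij(1)] w'D(1)[OF ij(2) that] by auto
    moreover have "z j \<noteq> w' i" if "i \<notin> G" using z_sub[OF ij(2)] w'D(1)[OF ij(1) that] by auto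
    moreover have "w' i \<noteq> w' j" if "i \<notin> G" "j \<notin> G"
      using w'(1) ij that by (auto simp: F_def dest: inj_onD)
    ultimately show ?thesis by (auto simp: M_def')
  qed
  have xX: "x i \<in> X" if "i \<in> I" for i using that by (simp add: X_def)
  have Xh: "X \<inter> set (h i) = {}" if "i \<in> I" for i using hS0[OF that] by (auto simp: S0_def)
  have XQ: "X \<inter> set (Q i) = {}" if "i \<in> I" for i using QV[OF that] by auto
  show ?thesis
  proof (intro exI[of _ R] conjI ballI)
    fix i assume i: "i \<in> I"
    note ne = linkageD(5)[OF Q i]
    show "hd (R i) = x i" by (simp add: R_def)
    show "last (R i) = y i" using lastQ[OF i] ne by (simp add: R_def)
    have xz: "(x i, z i) \<in> E" using zN[OF i] by (simp add: N_def)
    have "distinct (pre i @ [v i])"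
      using z_sub[OF i] w'D(1)[OF i] by (auto simp: pre_def v_def)
    then show "distinct (R i)"
      using h_dist[OF i] linkageD(2)[OF Q i] Mh[OF i i] MQ[OF i i] hQ[OF i i] MX[OF i] Xh[OF i] XQ[OF i] xX[OF i]
      unfolding R_def M_def by auto
    have "rel_walk E (x i # pre i @ [v i])"
      using xz w'D(3)[OF i] by (auto simp: pre_def v_def rel_walk_def)
    then have "rel_walk E ((x i # pre i) @ v i # (h i @ [s i]))"
      using rel_walk_crossover[of E "x i # pre i" "v i" "[]" "[]" "h i @ [s i]"] h_walk[OF i] by simp
    then have "rel_walk E ((x i # pre i @ [v i] @ h i) @ s i # [])" by simp
    moreover have "Q i = [] @ s i # tl (Q i)" using ne by (simp add: s_def)
    ultimately have "rel_walk E ((x i # pre i @ [v i] @ h i) @ s i # tl (Q i))"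
      using rel_walk_crossover QE[OF i] by metis
    then show "rel_walk E (R i)" using \<open>Q i = [] @ s i # tl (Q i)\<close> by (simp add: R_def)
  next
    show "disjoint_family_on (\<lambda>i. set (R i)) I"
      unfolding disjoint_family_on_def
    proof (intro ballI impI)
      fix i j assume ij: "i \<in> I" "j \<in> I" "i \<noteq> j"
      have "x i \<noteq> x j" using x(1) ij by (auto dest: inj_onD)
      moreover have "set (h i) \<inter> set (h j) = {}" "set (Q i) \<inter> set (Q j) = {}"
        using h_disj Q ij by (auto simp: linkage_def disjoint_family_on_def)
      moreover have "M i \<inter> M j = {}" "M i \<inter> set (h j) = {}" "M j \<inter> set (h i) = {}"
        "M i \<inter> set (Q j) = {}" "M j \<inter> set (Q i) = {}" "set (h i) \<inter> set (Q j) = {}" "set (h j) \<inter> set (Q i) = {}"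
        using MM Mh MQ hQ ij by simp_all
      moreover have "x i \<notin> M j" "x j \<notin> M i" "x i \<notin> set (h j)" "x j \<notin> set (h i)"
        "x i \<notin> set (Q j)" "x j \<notin> set (Q i)"
        using MX[of i] MX[of j] Xh[of i] Xh[of j] XQ[of i] XQ[of j] xX[of i] xX[of j] ij(1,2)
        by (simp_all add: disjoint_iff)
      ultimately show "set (R i) \<inter> set (R j) = {}"
        unfolding setR by (simp add: Int_Un_distrib Int_Un_distrib2 Int_commute)
    qed
  qed
qed

end

section \<open>Semicomplete digraphs\<close>

lemma rel_walk_arcs_ends_if_vwalk:
  assumes "vwalk p G" "arcs_ends G \<subseteq> E"
  shows "rel_walk E p"
proof -
  have "successively (\<lambda>u v. (u, v) \<in> E) p" if "set (vwalk_arcs p) \<subseteq> E"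
    using that by (induction p rule: vwalk_arcs.induct) auto
  then show ?thesis using assms by (auto simp: vwalk_def rel_walk_def)
qed

lemma vwalk_if_rel_walk_arcs_ends:
  assumes "rel_walk (arcs_ends G) p" "set p \<subseteq> verts G"
  shows "vwalk p G"
proof -
  have "set (vwalk_arcs p) \<subseteq> arcs_ends G" if "successively (\<lambda>u v. (u, v) \<in> arcs_ends G) p"
    using that by (induction p rule: vwalk_arcs.induct) auto
  then show ?thesis using assms by (auto simp: vwalk_def rel_walk_def)
qed

theorem theorem5:
  fixes D :: "('a, 'b) pre_digraph" and k :: nat
  assumes "k \<ge> 1"
    and "digraph D"
    and "semicomplete D"
    and "m_connected (2 * k + 1) D"
    and "min_out_degree D \<ge> 7 * k ^ 2 + 36 * k"
  shows "k_linked k D"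
proof -
  interpret digraph D by (rule assms(2))
  let ?V = "verts D" and ?E = "arcs_ends D"
  have arcs: "?E \<subseteq> ?V \<times> ?V" by (auto simp: arcs_ends_def arc_to_ends_def)
  interpret semicomplete_relation ?V ?E
  proof
    show "(v, v) \<notin> ?E" for v using no_loops by (auto simp: arcs_ends_def arc_to_ends_def)
    show "(u, v) \<in> ?E \<or> (v, u) \<in> ?E" if "u \<in> ?V" "v \<in> ?V" "u \<noteq> v" for u v
      using assms(3) that by (auto simp: semicomplete_def)
  qed (use arcs in auto)
  have deg: "7 * k\<^sup>2 + 36 * k \<le> card (?E `` {v})" if v: "v \<in> ?V" for v
  proof -
    have "{u \<in> ?V. v \<rightarrow>\<^bsub>D\<^esub> u} = ?E `` {v}" using arcs by auto
    then have "out_degree D v = card (?E `` {v})" by (simp add: out_degree_eq_card_out_neighbours)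
    moreover have "min_out_degree D \<le> out_degree D v"
      unfolding min_out_degree_def using v by (intro Min_le) auto
    ultimately show ?thesis using assms(5) by simp
  qed
  have conn: "\<exists>p. rel_walk ?E p \<and> hd p = a \<and> last p = b \<and> set p \<inter> S = {}"
    if S: "S \<subseteq> ?V" "card S \<le> 2 * k" and ab: "a \<in> ?V - S" "b \<in> ?V - S" "a \<noteq> b" for S a b
  proof -
    have "card S < 2 * k + 1" using S(2) by simp
    then obtain p where p: "vpath_betw (D \<restriction> (?V - S)) a p b"
      using assms(4) S(1) ab unfolding m_connected_def by blast
    then have "vwalk p (D \<restriction> (?V - S))" "hd p = a" "last p = b"
      by (auto simp: vpath_betw_def vpath_def)
    moreover have "arcs_ends (D \<restriction> (?V - S)) \<subseteq> ?E" by (auto intro: dominates_induce_subgraphD)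
    moreover have "set p \<inter> S = {}" using calculation(1) by (auto simp: vwalk_def)
    ultimately show ?thesis using rel_walk_arcs_ends_if_vwalk by blast
  qed
  show ?thesis
    unfolding k_linked_def
  proof (intro allI impI)
    fix x y :: "nat \<Rightarrow> 'a"
    assume xy: "x ` {1..k} \<subseteq> ?V \<and> y ` {1..k} \<subseteq> ?V \<and>
      inj_on x {1..k} \<and> inj_on y {1..k} \<and> x ` {1..k} \<inter> y ` {1..k} = {}"
    have "\<exists>R. (\<forall>i\<in>{1..k}. rel_walk ?E (R i) \<and> distinct (R i) \<and> hd (R i) = x i \<and> last (R i) = y i) \<and>
        disjoint_family_on (\<lambda>i. set (R i)) {1..k}"
      by (rule linked_if_highly_connected[OF assms(1) conn deg]) (use xy in simp_all)
    then obtain R where R: "\<And>i. i \<in> {1..k} \<Longrightarrow>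
        rel_walk ?E (R i) \<and> distinct (R i) \<and> hd (R i) = x i \<and> last (R i) = y i"
      and disj: "disjoint_family_on (\<lambda>i. set (R i)) {1..k}" by blast
    have "vpath_betw D (x i) (R i) (y i)" if i: "i \<in> {1..k}" for i
    proof -
      have "x i \<in> ?V" using xy i by auto
      then have "set (R i) \<subseteq> ?V" using R[OF i] arcs by (intro rel_walk_subset[of ?E]) auto
      then show ?thesis
        using R[OF i] vwalk_if_rel_walk_arcs_ends[of D "R i"] by (simp add: vpath_betw_def vpath_def)
    qed
    then show "\<exists>P. (\<forall>i\<in>{1..k}. vpath_betw D (x i) (P i) (y i)) \<and>
        (\<forall>i\<in>{1..k}. \<forall>j\<in>{1..k}. i \<noteq> j \<longrightarrow> set (P i) \<inter> set (P j) = {})"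
      using disj by (intro exI[of _ R]) (simp add: disjoint_family_on_def)
  qed
qed

end
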